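(* Let $\mathcal{C}$ be a rigid tensor category over a field $k$ satisfying the commutativity condition, and let $V\in\mathcal{C}$. If $V^{\otimes n}\otimes (V^{*})^{\otimes m}$ is semisimple for some integers $m,n\ge 0$, not both equal to $0$, then $V$ is semisimple. In particular, if $V^{\otimes n}$ is semisimple for some $n\ge 1$ then $V$ is semisimple.
   Context: All tensor categories over $k$ are rigid, $k$-linear abelian, with finite dimensional $\operatorname{Hom}$ spaces, with every object of finite length, and with $\operatorname{End}(\mathbf{1})=k$. The category $\mathcal{C}$ satisfies the commutativity condition if there exists a functorial isomorphism $c:\otimes\to\otimes^{op}$ (i.e. isomorphisms $c_{X,Y}:X\otimes Y\to Y\otimes X$ natural in $X,Y$) such that $c_{V,\mathbf 1}=c_{\mathbf 1,V}=id_V$ for every $V\in\mathcal{C}$ (identifying $V\otimes\mathbf 1$ and $\mathbf 1\otimes V$ with $V$). No hexagon axioms or symmetry are required. *)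

theory Defs
  imports "Jordan_Normal_Form.Missing_VectorSpace"
begin

section \<open>Categories\<close>

text \<open>
  Objects and arrows are carrier sets in arbitrary types.  Every arrow carries its source and
  target, so distinct Hom sets are disjoint; operations are only constrained on carriers and,
  for composition, on composable arrows.  The composite is written in the usual order:
  \<open>g \<cdot> f\<close> is "first \<open>f\<close>, then \<open>g\<close>".
\<close>

record ('o, 'a) cat =
  Ob :: "'o set"
  Ar :: "'a set"
  src :: "'a \<Rightarrow> 'o"
  tgt :: "'a \<Rightarrow> 'o"
  ident :: "'o \<Rightarrow> 'a"
  cmp :: "'a \<Rightarrow> 'a \<Rightarrow> 'a"  (infixl "\<cdot>\<index>" 70)

definition Hom :: "('o, 'a, 'm) cat_scheme \<Rightarrow> 'o \<Rightarrow> 'o \<Rightarrow> 'a set" where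
  "Hom C X Y = {f \<in> Ar C. src C f = X \<and> tgt C f = Y}"

locale category =
  fixes C :: "('o, 'a, 'm) cat_scheme" (structure)
  assumes src_closed: "f \<in> Ar C \<Longrightarrow> src C f \<in> Ob C"
    and tgt_closed: "f \<in> Ar C \<Longrightarrow> tgt C f \<in> Ob C"
    and ident_closed: "X \<in> Ob C \<Longrightarrow> ident C X \<in> Hom C X X"
    and cmp_closed: "f \<in> Hom C X Y \<Longrightarrow> g \<in> Hom C Y Z \<Longrightarrow> g \<cdot> f \<in> Hom C X Z"
    and cmp_assoc: "f \<in> Hom C W X \<Longrightarrow> g \<in> Hom C X Y \<Longrightarrow> h \<in> Hom C Y Z
      \<Longrightarrow> (h \<cdot> g) \<cdot> f = h \<cdot> (g \<cdot> f)"
    and cmp_ident_right: "f \<in> Hom C X Y \<Longrightarrow> f \<cdot> ident C X = f"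
    and cmp_ident_left: "f \<in> Hom C X Y \<Longrightarrow> ident C Y \<cdot> f = f"

definition is_inverse :: "('o, 'a, 'm) cat_scheme \<Rightarrow> 'a \<Rightarrow> 'a \<Rightarrow> bool" where
  "is_inverse C f g \<longleftrightarrow> f \<in> Ar C \<and> g \<in> Hom C (tgt C f) (src C f) \<and>
     g \<cdot>\<^bsub>C\<^esub> f = ident C (src C f) \<and> f \<cdot>\<^bsub>C\<^esub> g = ident C (tgt C f)"

definition is_iso :: "('o, 'a, 'm) cat_scheme \<Rightarrow> 'a \<Rightarrow> bool" where
  "is_iso C f \<longleftrightarrow> (\<exists>g. is_inverse C f g)"

text \<open>Only meaningful when \<open>f\<close> is an isomorphism.\<close>

definition inverse_arrow :: "('o, 'a, 'm) cat_scheme \<Rightarrow> 'a \<Rightarrow> 'a" where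
  "inverse_arrow C f = (THE g. is_inverse C f g)"

definition is_mono :: "('o, 'a, 'm) cat_scheme \<Rightarrow> 'a \<Rightarrow> bool" where
  "is_mono C f \<longleftrightarrow> f \<in> Ar C \<and>
     (\<forall>W \<in> Ob C. \<forall>g \<in> Hom C W (src C f). \<forall>h \<in> Hom C W (src C f).
        f \<cdot>\<^bsub>C\<^esub> g = f \<cdot>\<^bsub>C\<^esub> h \<longrightarrow> g = h)"

definition is_epi :: "('o, 'a, 'm) cat_scheme \<Rightarrow> 'a \<Rightarrow> bool" where
  "is_epi C f \<longleftrightarrow> f \<in> Ar C \<and>
     (\<forall>Z \<in> Ob C. \<forall>g \<in> Hom C (tgt C f) Z. \<forall>h \<in> Hom C (tgt C f) Z.
        g \<cdot>\<^bsub>C\<^esub> f = h \<cdot>\<^bsub>C\<^esub> f \<longrightarrow> g = h)"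

definition is_zero_object :: "('o, 'a, 'm) cat_scheme \<Rightarrow> 'o \<Rightarrow> bool" where
  "is_zero_object C Z \<longleftrightarrow> Z \<in> Ob C \<and>
     (\<forall>X \<in> Ob C. (\<exists>!f. f \<in> Hom C X Z) \<and> (\<exists>!f. f \<in> Hom C Z X))"

definition is_simple :: "('o, 'a, 'm) cat_scheme \<Rightarrow> 'o \<Rightarrow> bool" where
  "is_simple C S \<longleftrightarrow> S \<in> Ob C \<and> \<not> is_zero_object C S \<and>
     (\<forall>f. is_mono C f \<and> tgt C f = S \<longrightarrow> is_zero_object C (src C f) \<or> is_iso C f)"


section \<open>Linear and abelian categories\<close>

record ('o, 'a, 'k) linear_cat = "('o, 'a) cat" +
  arr_add :: "'a \<Rightarrow> 'a \<Rightarrow> 'a"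
  arr_zero :: "'o \<Rightarrow> 'o \<Rightarrow> 'a"
  arr_scale :: "'k \<Rightarrow> 'a \<Rightarrow> 'a"

text \<open>
  A Hom set as a module in the sense of \<open>HOL-Algebra\<close>.  The record type of modules also has
  slots for a multiplication and a unit, which no module axiom mentions.
\<close>

definition hom_space ::
    "('o, 'a, 'k, 'm) linear_cat_scheme \<Rightarrow> 'o \<Rightarrow> 'o \<Rightarrow> ('k, 'a) module" where
  "hom_space C X Y =
     \<lparr>carrier = Hom C X Y, mult = undefined, one = undefined,
      zero = arr_zero C X Y, add = arr_add C, smult = arr_scale C\<rparr>"

text \<open>
  \<open>X\<close> is a direct sum (biproduct) of the objects \<open>S 0, \<dots>, S (n - 1)\<close>;
  the sum in the last clause is taken in the vector space \<open>Hom X X\<close>.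
  For \<open>n = 0\<close> the condition says that the identity of \<open>X\<close> is zero.
\<close>

definition is_direct_sum ::
    "('o, 'a, 'k, 'm) linear_cat_scheme \<Rightarrow> nat \<Rightarrow> (nat \<Rightarrow> 'o) \<Rightarrow> 'o \<Rightarrow> bool" where
  "is_direct_sum C n S X \<longleftrightarrow> X \<in> Ob C \<and> (\<forall>i<n. S i \<in> Ob C) \<and>
     (\<exists>\<iota> \<pi>. (\<forall>i<n. \<iota> i \<in> Hom C (S i) X \<and> \<pi> i \<in> Hom C X (S i)) \<and>
       (\<forall>i<n. \<forall>j<n. \<pi> i \<cdot>\<^bsub>C\<^esub> \<iota> j =
          (if i = j then ident C (S i) else arr_zero C (S j) (S i))) \<and>
       finsum (hom_space C X X) (\<lambda>i. \<iota> i \<cdot>\<^bsub>C\<^esub> \<pi> i) {..<n} = ident C X)"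

definition is_semisimple :: "('o, 'a, 'k, 'm) linear_cat_scheme \<Rightarrow> 'o \<Rightarrow> bool" where
  "is_semisimple C X \<longleftrightarrow> (\<exists>n S. (\<forall>i<n. is_simple C (S i)) \<and> is_direct_sum C n S X)"

definition is_kernel :: "('o, 'a, 'k, 'm) linear_cat_scheme \<Rightarrow> 'a \<Rightarrow> 'a \<Rightarrow> bool" where
  "is_kernel C f k \<longleftrightarrow> f \<in> Ar C \<and> k \<in> Ar C \<and> tgt C k = src C f \<and>
     f \<cdot>\<^bsub>C\<^esub> k = arr_zero C (src C k) (tgt C f) \<and>
     (\<forall>W \<in> Ob C. \<forall>h \<in> Hom C W (src C f). f \<cdot>\<^bsub>C\<^esub> h = arr_zero C W (tgt C f) \<longrightarrow>
        (\<exists>!u. u \<in> Hom C W (src C k) \<and> k \<cdot>\<^bsub>C\<^esub> u = h))"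

definition is_cokernel :: "('o, 'a, 'k, 'm) linear_cat_scheme \<Rightarrow> 'a \<Rightarrow> 'a \<Rightarrow> bool" where
  "is_cokernel C f q \<longleftrightarrow> f \<in> Ar C \<and> q \<in> Ar C \<and> src C q = tgt C f \<and>
     q \<cdot>\<^bsub>C\<^esub> f = arr_zero C (src C f) (tgt C q) \<and>
     (\<forall>Z \<in> Ob C. \<forall>h \<in> Hom C (tgt C f) Z. h \<cdot>\<^bsub>C\<^esub> f = arr_zero C (src C f) Z \<longrightarrow>
        (\<exists>!u. u \<in> Hom C (tgt C q) Z \<and> u \<cdot>\<^bsub>C\<^esub> q = h))"

text \<open>
  Finite length: there is a filtration \<open>0 = Y 0 \<subseteq> Y 1 \<subseteq> \<dots> \<subseteq> Y n = X\<close>, given by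
  monomorphisms \<open>j i : Y i \<rightarrow> Y (i + 1)\<close>, whose successive quotients are simple.
\<close>

definition has_finite_length :: "('o, 'a, 'k, 'm) linear_cat_scheme \<Rightarrow> 'o \<Rightarrow> bool" where
  "has_finite_length C X \<longleftrightarrow> (\<exists>n Y j. is_zero_object C (Y 0) \<and> Y n = X \<and>
     (\<forall>i<n. j i \<in> Hom C (Y i) (Y (Suc i)) \<and> is_mono C (j i) \<and>
        (\<exists>q. is_cokernel C (j i) q \<and> is_simple C (tgt C q))))"

locale linear_category = category C + field K
  for K :: "('k, 'r) ring_scheme" and C :: "('o, 'a, 'k, 'm) linear_cat_scheme" (structure) +
  assumes hom_vectorspace:
      "X \<in> Ob C \<Longrightarrow> Y \<in> Ob C \<Longrightarrow> vectorspace K (hom_space C X Y)"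
    and cmp_add_right: "f \<in> Hom C X Y \<Longrightarrow> f' \<in> Hom C X Y \<Longrightarrow> g \<in> Hom C Y Z
      \<Longrightarrow> g \<cdot> arr_add C f f' = arr_add C (g \<cdot> f) (g \<cdot> f')"
    and cmp_add_left: "f \<in> Hom C X Y \<Longrightarrow> g \<in> Hom C Y Z \<Longrightarrow> g' \<in> Hom C Y Z
      \<Longrightarrow> arr_add C g g' \<cdot> f = arr_add C (g \<cdot> f) (g' \<cdot> f)"
    and cmp_scale_right: "a \<in> carrier K \<Longrightarrow> f \<in> Hom C X Y \<Longrightarrow> g \<in> Hom C Y Z
      \<Longrightarrow> g \<cdot> arr_scale C a f = arr_scale C a (g \<cdot> f)"
    and cmp_scale_left: "a \<in> carrier K \<Longrightarrow> f \<in> Hom C X Y \<Longrightarrow> g \<in> Hom C Y Z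
      \<Longrightarrow> arr_scale C a g \<cdot> f = arr_scale C a (g \<cdot> f)"

text \<open>
  Existence of finite direct sums includes the empty one, hence a zero object.
\<close>

locale abelian_linear_category = linear_category K C
  for K :: "('k, 'r) ring_scheme" and C :: "('o, 'a, 'k, 'm) linear_cat_scheme" (structure) +
  assumes direct_sums_exist:
      "\<And>n S. (\<And>i. i < n \<Longrightarrow> S i \<in> Ob C) \<Longrightarrow> \<exists>X. is_direct_sum C n S X"
    and kernels_exist: "f \<in> Ar C \<Longrightarrow> \<exists>k. is_kernel C f k"
    and cokernels_exist: "f \<in> Ar C \<Longrightarrow> \<exists>q. is_cokernel C f q"
    and mono_is_kernel: "is_mono C m \<Longrightarrow> \<exists>f. is_kernel C f m"
    and epi_is_cokernel: "is_epi C e \<Longrightarrow> \<exists>f. is_cokernel C f e"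


section \<open>Rigid tensor categories\<close>

record ('o, 'a, 'k) tensor_cat = "('o, 'a, 'k) linear_cat" +
  tensor_ob :: "'o \<Rightarrow> 'o \<Rightarrow> 'o"  (infixr "\<otimes>\<^sub>o\<index>" 75)
  tensor_ar :: "'a \<Rightarrow> 'a \<Rightarrow> 'a"  (infixr "\<otimes>\<^sub>a\<index>" 75)
  unit_ob :: "'o"
  assoc :: "'o \<Rightarrow> 'o \<Rightarrow> 'o \<Rightarrow> 'a"
  lunit :: "'o \<Rightarrow> 'a"
  runit :: "'o \<Rightarrow> 'a"

text \<open>
  The associator goes from \<open>(X \<otimes> Y) \<otimes> Z\<close> to \<open>X \<otimes> (Y \<otimes> Z)\<close>, the unitors from
  \<open>1 \<otimes> X\<close> and \<open>X \<otimes> 1\<close> to \<open>X\<close>.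
\<close>

locale monoidal_category = category C
  for C :: "('o, 'a, 'k, 'm) tensor_cat_scheme" (structure) +
  assumes tensor_ob_closed: "X \<in> Ob C \<Longrightarrow> Y \<in> Ob C \<Longrightarrow> X \<otimes>\<^sub>o Y \<in> Ob C"
    and tensor_ar_closed: "f \<in> Hom C X X' \<Longrightarrow> g \<in> Hom C Y Y'
      \<Longrightarrow> f \<otimes>\<^sub>a g \<in> Hom C (X \<otimes>\<^sub>o Y) (X' \<otimes>\<^sub>o Y')"
    and tensor_ident: "X \<in> Ob C \<Longrightarrow> Y \<in> Ob C
      \<Longrightarrow> ident C X \<otimes>\<^sub>a ident C Y = ident C (X \<otimes>\<^sub>o Y)"
    and tensor_cmp: "f \<in> Hom C X X' \<Longrightarrow> f' \<in> Hom C X' X'' \<Longrightarrow> g \<in> Hom C Y Y' \<Longrightarrow> g' \<in> Hom C Y' Y''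
      \<Longrightarrow> (f' \<cdot> f) \<otimes>\<^sub>a (g' \<cdot> g) = (f' \<otimes>\<^sub>a g') \<cdot> (f \<otimes>\<^sub>a g)"
    and unit_ob_closed: "unit_ob C \<in> Ob C"
    and assoc_closed: "X \<in> Ob C \<Longrightarrow> Y \<in> Ob C \<Longrightarrow> Z \<in> Ob C
      \<Longrightarrow> assoc C X Y Z \<in> Hom C ((X \<otimes>\<^sub>o Y) \<otimes>\<^sub>o Z) (X \<otimes>\<^sub>o (Y \<otimes>\<^sub>o Z))"
    and assoc_iso: "X \<in> Ob C \<Longrightarrow> Y \<in> Ob C \<Longrightarrow> Z \<in> Ob C \<Longrightarrow> is_iso C (assoc C X Y Z)"
    and assoc_natural: "f \<in> Hom C X X' \<Longrightarrow> g \<in> Hom C Y Y' \<Longrightarrow> h \<in> Hom C Z Z'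
      \<Longrightarrow> assoc C X' Y' Z' \<cdot> ((f \<otimes>\<^sub>a g) \<otimes>\<^sub>a h) = (f \<otimes>\<^sub>a (g \<otimes>\<^sub>a h)) \<cdot> assoc C X Y Z"
    and lunit_closed: "X \<in> Ob C \<Longrightarrow> lunit C X \<in> Hom C (unit_ob C \<otimes>\<^sub>o X) X"
    and lunit_iso: "X \<in> Ob C \<Longrightarrow> is_iso C (lunit C X)"
    and lunit_natural: "f \<in> Hom C X Y
      \<Longrightarrow> lunit C Y \<cdot> (ident C (unit_ob C) \<otimes>\<^sub>a f) = f \<cdot> lunit C X"
    and runit_closed: "X \<in> Ob C \<Longrightarrow> runit C X \<in> Hom C (X \<otimes>\<^sub>o unit_ob C) X"
    and runit_iso: "X \<in> Ob C \<Longrightarrow> is_iso C (runit C X)"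
    and runit_natural: "f \<in> Hom C X Y
      \<Longrightarrow> runit C Y \<cdot> (f \<otimes>\<^sub>a ident C (unit_ob C)) = f \<cdot> runit C X"
    and pentagon: "W \<in> Ob C \<Longrightarrow> X \<in> Ob C \<Longrightarrow> Y \<in> Ob C \<Longrightarrow> Z \<in> Ob C
      \<Longrightarrow> assoc C W X (Y \<otimes>\<^sub>o Z) \<cdot> assoc C (W \<otimes>\<^sub>o X) Y Z =
          (ident C W \<otimes>\<^sub>a assoc C X Y Z) \<cdot> assoc C W (X \<otimes>\<^sub>o Y) Z \<cdot> (assoc C W X Y \<otimes>\<^sub>a ident C Z)"
    and triangle: "X \<in> Ob C \<Longrightarrow> Y \<in> Ob C
      \<Longrightarrow> (ident C X \<otimes>\<^sub>a lunit C Y) \<cdot> assoc C X (unit_ob C) Y = runit C X \<otimes>\<^sub>a ident C Y"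

text \<open>
  \<open>W\<close> is a left dual of \<open>V\<close>: there are an evaluation \<open>W \<otimes> V \<rightarrow> 1\<close> and a coevaluation
  \<open>1 \<rightarrow> V \<otimes> W\<close> for which the two zigzag composites
  \<open>V \<rightarrow> 1 \<otimes> V \<rightarrow> (V \<otimes> W) \<otimes> V \<rightarrow> V \<otimes> (W \<otimes> V) \<rightarrow> V \<otimes> 1 \<rightarrow> V\<close> and
  \<open>W \<rightarrow> W \<otimes> 1 \<rightarrow> W \<otimes> (V \<otimes> W) \<rightarrow> (W \<otimes> V) \<otimes> W \<rightarrow> 1 \<otimes> W \<rightarrow> W\<close> are identities.
  Equivalently, \<open>V\<close> is a right dual of \<open>W\<close>.
\<close>

definition is_left_dual :: "('o, 'a, 'k, 'm) tensor_cat_scheme \<Rightarrow> 'o \<Rightarrow> 'o \<Rightarrow> bool" where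
  "is_left_dual C V W \<longleftrightarrow> V \<in> Ob C \<and> W \<in> Ob C \<and>
     (\<exists>ev \<in> Hom C (W \<otimes>\<^sub>o\<^bsub>C\<^esub> V) (unit_ob C). \<exists>coev \<in> Hom C (unit_ob C) (V \<otimes>\<^sub>o\<^bsub>C\<^esub> W).
        runit C V \<cdot>\<^bsub>C\<^esub> (ident C V \<otimes>\<^sub>a\<^bsub>C\<^esub> ev) \<cdot>\<^bsub>C\<^esub> assoc C V W V \<cdot>\<^bsub>C\<^esub>
          (coev \<otimes>\<^sub>a\<^bsub>C\<^esub> ident C V) \<cdot>\<^bsub>C\<^esub> inverse_arrow C (lunit C V) = ident C V \<and>
        lunit C W \<cdot>\<^bsub>C\<^esub> (ev \<otimes>\<^sub>a\<^bsub>C\<^esub> ident C W) \<cdot>\<^bsub>C\<^esub> inverse_arrow C (assoc C W V W) \<cdot>\<^bsub>C\<^esub>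
          (ident C W \<otimes>\<^sub>a\<^bsub>C\<^esub> coev) \<cdot>\<^bsub>C\<^esub> inverse_arrow C (runit C W) = ident C W)"

locale rigid_tensor_category = abelian_linear_category K C + monoidal_category C
  for K :: "('k, 'r) ring_scheme" and C :: "('o, 'a, 'k, 'm) tensor_cat_scheme" (structure) +
  assumes tensor_add_left: "f \<in> Hom C X X' \<Longrightarrow> f' \<in> Hom C X X' \<Longrightarrow> g \<in> Hom C Y Y'
      \<Longrightarrow> arr_add C f f' \<otimes>\<^sub>a g = arr_add C (f \<otimes>\<^sub>a g) (f' \<otimes>\<^sub>a g)"
    and tensor_add_right: "f \<in> Hom C X X' \<Longrightarrow> g \<in> Hom C Y Y' \<Longrightarrow> g' \<in> Hom C Y Y'
      \<Longrightarrow> f \<otimes>\<^sub>a arr_add C g g' = arr_add C (f \<otimes>\<^sub>a g) (f \<otimes>\<^sub>a g')"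
    and tensor_scale_left: "a \<in> carrier K \<Longrightarrow> f \<in> Hom C X X' \<Longrightarrow> g \<in> Hom C Y Y'
      \<Longrightarrow> arr_scale C a f \<otimes>\<^sub>a g = arr_scale C a (f \<otimes>\<^sub>a g)"
    and tensor_scale_right: "a \<in> carrier K \<Longrightarrow> f \<in> Hom C X X' \<Longrightarrow> g \<in> Hom C Y Y'
      \<Longrightarrow> f \<otimes>\<^sub>a arr_scale C a g = arr_scale C a (f \<otimes>\<^sub>a g)"
    and hom_fin_dim:
      "X \<in> Ob C \<Longrightarrow> Y \<in> Ob C \<Longrightarrow> vectorspace.fin_dim K (hom_space C X Y)"
    and finite_length: "X \<in> Ob C \<Longrightarrow> has_finite_length C X"
    and end_unit: "bij_betw (\<lambda>a. arr_scale C a (ident C (unit_ob C))) (carrier K)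
        (Hom C (unit_ob C) (unit_ob C))"
    and left_duals_exist: "V \<in> Ob C \<Longrightarrow> \<exists>W. is_left_dual C V W"
    and right_duals_exist: "V \<in> Ob C \<Longrightarrow> \<exists>W. is_left_dual C W V"

text \<open>
  Under the identifications of \<open>V \<otimes> 1\<close> and \<open>1 \<otimes> V\<close> with \<open>V\<close> by the unitors, the last two
  clauses say that \<open>c V 1\<close> and \<open>c 1 V\<close> are the identity of \<open>V\<close>.
\<close>

definition commutativity_condition :: "('o, 'a, 'k, 'm) tensor_cat_scheme \<Rightarrow> bool" where
  "commutativity_condition C \<longleftrightarrow> (\<exists>c.
     (\<forall>X \<in> Ob C. \<forall>Y \<in> Ob C.
        c X Y \<in> Hom C (X \<otimes>\<^sub>o\<^bsub>C\<^esub> Y) (Y \<otimes>\<^sub>o\<^bsub>C\<^esub> X) \<and> is_iso C (c X Y)) \<and>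
     (\<forall>X \<in> Ob C. \<forall>X' \<in> Ob C. \<forall>Y \<in> Ob C. \<forall>Y' \<in> Ob C.
        \<forall>f \<in> Hom C X X'. \<forall>g \<in> Hom C Y Y'.
          c X' Y' \<cdot>\<^bsub>C\<^esub> (f \<otimes>\<^sub>a\<^bsub>C\<^esub> g) = (g \<otimes>\<^sub>a\<^bsub>C\<^esub> f) \<cdot>\<^bsub>C\<^esub> c X Y) \<and>
     (\<forall>V \<in> Ob C.
        lunit C V \<cdot>\<^bsub>C\<^esub> c V (unit_ob C) \<cdot>\<^bsub>C\<^esub> inverse_arrow C (runit C V) = ident C V \<and>
        runit C V \<cdot>\<^bsub>C\<^esub> c (unit_ob C) V \<cdot>\<^bsub>C\<^esub> inverse_arrow C (lunit C V) = ident C V))"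

primrec tensor_power :: "('o, 'a, 'k, 'm) tensor_cat_scheme \<Rightarrow> 'o \<Rightarrow> nat \<Rightarrow> 'o" where
  "tensor_power C V 0 = unit_ob C"
| "tensor_power C V (Suc n) = tensor_power C V n \<otimes>\<^sub>o\<^bsub>C\<^esub> V"

end

theory Submission
  imports Defs
begin

text \<open>
  Let \<open>f : W \<rightarrow> V\<close> be a monomorphism.  Because \<open>W\<close> embeds into \<open>V\<close> and \<open>V\<^sup>*\<close> covers \<open>W\<^sup>*\<close>,
  the object \<open>V \<otimes> Z\<close> with \<open>Z = W\<^sup>n\<^sup>-\<^sup>1 \<otimes> (W\<^sup>*)\<^sup>m\<close> is a subquotient of \<open>V\<^sup>n \<otimes> (V\<^sup>*)\<^sup>m\<close>, so
  semisimplicity of the latter splits \<open>f \<otimes> Z\<close>.  The factors of \<open>Z\<close> can then be removed one by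
  one: the coevaluation \<open>X \<rightarrow> W \<otimes> W\<^sup>* \<otimes> X\<close> is natural in \<open>X\<close>, and by a zigzag identity it is split
  for \<open>X = W \<otimes> X'\<close>, so an arrow \<open>g\<close> out of such an \<open>X\<close> splits as soon as \<open>W \<otimes> W\<^sup>* \<otimes> g\<close> does;
  commutativity moves the factors into that position.  When \<open>n = 0\<close> the argument applies to
  \<open>V\<^sup>*\<close>, and a section of the transpose \<open>V\<^sup>* \<rightarrow> W\<^sup>*\<close> of \<open>f\<close> transposes to a retraction of \<open>f\<close>.
\<close>

section \<open>Split, mono and epi arrows\<close>

text \<open>The factors of Z are copies of W and its dual rather than of V because a factor can be
  removed only through the coevaluation at the source of the arrow, and the source of f \<otimes> Z
  starts with W. This is the reason for passing to a subquotient, in which one factor V is kept as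
  the target of f and all others are replaced. Splittings are handled through
  \<open>complemented\<close>: every mono into the object splits. For objects of finite length this
  is semisimplicity, and it descends to subobjects and quotients without any choice of
  decomposition. The commutativity isomorphism obeys no hexagon, so nothing can depend on how
  several swaps compose. Only the property of being a split mono is carried across swaps, and that
  property is invariant under any commuting square with invertible sides. A second left dual need
  not return V. Hence for n = 0 the argument yields a statement about the dual of V, which has to be
  brought back to V by transposition.\<close>

lemma Hom_iff: "f \<in> Hom C X Y \<longleftrightarrow> f \<in> Ar C \<and> src C f = X \<and> tgt C f = Y"
  by (auto simp: Hom_def)

definition split_mono :: "('o, 'a, 'm) cat_scheme \<Rightarrow> 'a \<Rightarrow> bool" where
  "split_mono C g \<longleftrightarrow> g \<in> Ar C \<and>
     (\<exists>r \<in> Hom C (tgt C g) (src C g). r \<cdot>\<^bsub>C\<^esub> g = ident C (src C g))"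

definition split_epi :: "('o, 'a, 'm) cat_scheme \<Rightarrow> 'a \<Rightarrow> bool" where
  "split_epi C e \<longleftrightarrow> e \<in> Ar C \<and>
     (\<exists>s \<in> Hom C (tgt C e) (src C e). e \<cdot>\<^bsub>C\<^esub> s = ident C (tgt C e))"

text \<open>Working substitute for semisimplicity: a decomposition into simples is awkward to
  restrict to a subobject, whereas this condition is checked on one mono at a time.\<close>

definition complemented :: "('o, 'a, 'm) cat_scheme \<Rightarrow> 'o \<Rightarrow> bool" where
  "complemented C X \<longleftrightarrow> X \<in> Ob C \<and> (\<forall>m. is_mono C m \<and> tgt C m = X \<longrightarrow> split_mono C m)"

text \<open>Here and in \<open>covers\<close> the arrow is forgotten, since the comparison of
  iterated tensor products needs only that some mono or epi exists.\<close>

definition embeds :: "('o, 'a, 'm) cat_scheme \<Rightarrow> 'o \<Rightarrow> 'o \<Rightarrow> bool" where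
  "embeds C A B \<longleftrightarrow> (\<exists>f \<in> Hom C A B. is_mono C f)"

definition covers :: "('o, 'a, 'm) cat_scheme \<Rightarrow> 'o \<Rightarrow> 'o \<Rightarrow> bool" where
  "covers C A B \<longleftrightarrow> (\<exists>f \<in> Hom C A B. is_epi C f)"

context category
begin

lemma Ob_src_tgt [simp]: "f \<in> Ar C \<Longrightarrow> src C f \<in> Ob C" "f \<in> Ar C \<Longrightarrow> tgt C f \<in> Ob C"
  by (simp_all add: src_closed tgt_closed)

lemma HomD: "f \<in> Hom C X Y \<Longrightarrow> f \<in> Ar C" "f \<in> Hom C X Y \<Longrightarrow> src C f = X"
  "f \<in> Hom C X Y \<Longrightarrow> tgt C f = Y" "f \<in> Hom C X Y \<Longrightarrow> X \<in> Ob C" "f \<in> Hom C X Y \<Longrightarrow> Y \<in> Ob C"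
  by (auto simp: Hom_iff)

lemma Hom_self: "f \<in> Ar C \<Longrightarrow> f \<in> Hom C (src C f) (tgt C f)"
  by (simp add: Hom_iff)

lemma ident_simps [simp]: "X \<in> Ob C \<Longrightarrow> ident C X \<in> Ar C"
  "X \<in> Ob C \<Longrightarrow> src C (ident C X) = X" "X \<in> Ob C \<Longrightarrow> tgt C (ident C X) = X"
  using ident_closed[of X] by (auto simp: Hom_iff)

lemma cmp_simps [simp]:
  assumes "f \<in> Ar C" "g \<in> Ar C" "tgt C f = src C g"
  shows "g \<cdot> f \<in> Ar C" "src C (g \<cdot> f) = src C f" "tgt C (g \<cdot> f) = tgt C g"
  using cmp_closed[of f "src C f" "tgt C f" g "tgt C g"] assms by (auto simp: Hom_iff)

lemma cmp_ident [simp]: "f \<in> Ar C \<Longrightarrow> src C f = X \<Longrightarrow> f \<cdot> ident C X = f"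
  "f \<in> Ar C \<Longrightarrow> tgt C f = X \<Longrightarrow> ident C X \<cdot> f = f"
  by (auto intro!: cmp_ident_right cmp_ident_left simp: Hom_iff)

lemma cmp_cmp: "f \<in> Ar C \<Longrightarrow> g \<in> Ar C \<Longrightarrow> h \<in> Ar C \<Longrightarrow> tgt C f = src C g \<Longrightarrow> tgt C g = src C h
    \<Longrightarrow> (h \<cdot> g) \<cdot> f = h \<cdot> (g \<cdot> f)"
  by (rule cmp_assoc) (auto simp: Hom_iff)

text \<open>Composites are normalised to right-nested form, where a known equation for
  \<open>b \<cdot> a\<close> no longer matches literally; this applies it at the head of a longer
  composite.\<close>

lemma cmp_reassoc: "b \<cdot> a = c \<Longrightarrow> a \<in> Ar C \<Longrightarrow> b \<in> Ar C \<Longrightarrow> tgt C a = src C b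
    \<Longrightarrow> x \<in> Ar C \<Longrightarrow> tgt C x = src C a \<Longrightarrow> b \<cdot> (a \<cdot> x) = c \<cdot> x"
  using cmp_cmp[of x a b] by simp

section \<open>Cancellation and factorisation of arrows\<close>

lemma is_monoD: "is_mono C f \<Longrightarrow> f \<cdot> g = f \<cdot> h \<Longrightarrow> g \<in> Ar C \<Longrightarrow> h \<in> Ar C
    \<Longrightarrow> tgt C g = src C f \<Longrightarrow> tgt C h = src C f \<Longrightarrow> src C g = src C h \<Longrightarrow> g = h"
  unfolding is_mono_def by (metis Hom_self Ob_src_tgt(1))

lemma is_monoI:
  assumes "f \<in> Ar C"
    and "\<And>g h. g \<in> Ar C \<Longrightarrow> h \<in> Ar C \<Longrightarrow> tgt C g = src C f \<Longrightarrow> tgt C h = src C f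
      \<Longrightarrow> src C g = src C h \<Longrightarrow> f \<cdot> g = f \<cdot> h \<Longrightarrow> g = h"
  shows "is_mono C f"
  unfolding is_mono_def using assms by (auto simp: Hom_iff)

lemma is_epiD: "is_epi C f \<Longrightarrow> g \<cdot> f = h \<cdot> f \<Longrightarrow> g \<in> Ar C \<Longrightarrow> h \<in> Ar C
    \<Longrightarrow> src C g = tgt C f \<Longrightarrow> src C h = tgt C f \<Longrightarrow> tgt C g = tgt C h \<Longrightarrow> g = h"
  unfolding is_epi_def by (metis Hom_self Ob_src_tgt(2))

lemma is_epiI:
  assumes "f \<in> Ar C"
    and "\<And>g h. g \<in> Ar C \<Longrightarrow> h \<in> Ar C \<Longrightarrow> src C g = tgt C f \<Longrightarrow> src C h = tgt C f
      \<Longrightarrow> tgt C g = tgt C h \<Longrightarrow> g \<cdot> f = h \<cdot> f \<Longrightarrow> g = h"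
  shows "is_epi C f"
  unfolding is_epi_def using assms by (auto simp: Hom_iff)

lemma is_mono_Ar: "is_mono C f \<Longrightarrow> f \<in> Ar C"
  by (simp add: is_mono_def)

lemma is_epi_Ar: "is_epi C f \<Longrightarrow> f \<in> Ar C"
  by (simp add: is_epi_def)

lemma split_monoI: "r \<cdot> g = ident C (src C g) \<Longrightarrow> g \<in> Ar C \<Longrightarrow> r \<in> Ar C
    \<Longrightarrow> src C r = tgt C g \<Longrightarrow> tgt C r = src C g \<Longrightarrow> split_mono C g"
  unfolding split_mono_def by (auto simp: Hom_iff)

lemma split_monoE:
  assumes "split_mono C g"
  obtains r where "g \<in> Ar C" "r \<in> Ar C" "src C r = tgt C g" "tgt C r = src C g"
    "r \<cdot> g = ident C (src C g)"
  using assms unfolding split_mono_def by (auto simp: Hom_iff)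

lemma split_epiE:
  assumes "split_epi C e"
  obtains s where "e \<in> Ar C" "s \<in> Ar C" "src C s = tgt C e" "tgt C s = src C e"
    "e \<cdot> s = ident C (tgt C e)"
  using assms unfolding split_epi_def by (auto simp: Hom_iff)

lemma split_mono_mono:
  assumes "split_mono C g"
  shows "is_mono C g"
proof -
  obtain r where r: "g \<in> Ar C" "r \<in> Ar C" "src C r = tgt C g" "tgt C r = src C g"
    "r \<cdot> g = ident C (src C g)"
    using assms by (rule split_monoE)
  show ?thesis
  proof (rule is_monoI)
    fix a b assume "a \<in> Ar C" "b \<in> Ar C" "tgt C a = src C g" "tgt C b = src C g" "g \<cdot> a = g \<cdot> b"
    then show "a = b" using r cmp_cmp[of a g r] cmp_cmp[of b g r] by simp
  qed (use r in simp)
qed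

lemma is_mono_cmp:
  assumes "is_mono C f" "is_mono C g" "tgt C f = src C g"
  shows "is_mono C (g \<cdot> f)"
proof (rule is_monoI)
  have [simp]: "f \<in> Ar C" "g \<in> Ar C" using assms by (auto simp: is_mono_Ar)
  show "g \<cdot> f \<in> Ar C" using assms by simp
  fix a b assume [simp]: "a \<in> Ar C" "b \<in> Ar C"
    and "tgt C a = src C (g \<cdot> f)" "tgt C b = src C (g \<cdot> f)"
    and s: "src C a = src C b" and eq: "g \<cdot> f \<cdot> a = g \<cdot> f \<cdot> b"
  then have t: "tgt C a = src C f" "tgt C b = src C f" using assms by auto
  have "g \<cdot> (f \<cdot> a) = g \<cdot> (f \<cdot> b)" using eq t assms by (simp add: cmp_cmp)
  then have "f \<cdot> a = f \<cdot> b" using is_monoD[OF assms(2)] t s assms(3) by simp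
  then show "a = b" using is_monoD[OF assms(1)] t s by simp
qed

lemma is_mono_right_factor:
  assumes "is_mono C (h \<cdot> g)" "g \<in> Ar C" "h \<in> Ar C" "tgt C g = src C h"
  shows "is_mono C g"
proof (rule is_monoI[OF assms(2)])
  fix a b assume *: "a \<in> Ar C" "b \<in> Ar C" "tgt C a = src C g" "tgt C b = src C g"
    "src C a = src C b" "g \<cdot> a = g \<cdot> b"
  then have "(h \<cdot> g) \<cdot> a = (h \<cdot> g) \<cdot> b" using assms(2-4) by (simp add: cmp_cmp)
  then show "a = b" by (rule is_monoD[OF assms(1)]) (use * assms(2-4) in simp_all)
qed

lemma is_epi_cmp:
  assumes "is_epi C f" "is_epi C g" "tgt C f = src C g"
  shows "is_epi C (g \<cdot> f)"
proof (rule is_epiI)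
  have [simp]: "f \<in> Ar C" "g \<in> Ar C" using assms by (auto simp: is_epi_Ar)
  show "g \<cdot> f \<in> Ar C" using assms by simp
  fix a b assume [simp]: "a \<in> Ar C" "b \<in> Ar C"
    and "src C a = tgt C (g \<cdot> f)" "src C b = tgt C (g \<cdot> f)"
    and s: "tgt C a = tgt C b" and eq: "a \<cdot> (g \<cdot> f) = b \<cdot> (g \<cdot> f)"
  then have t: "src C a = tgt C g" "src C b = tgt C g" using assms by auto
  have "(a \<cdot> g) \<cdot> f = (b \<cdot> g) \<cdot> f" using eq t assms by (simp add: cmp_cmp)
  then have "a \<cdot> g = b \<cdot> g" using is_epiD[OF assms(1)] t s assms(3) by simp
  then show "a = b" using is_epiD[OF assms(2)] t s by simp
qed

lemma split_mono_right_factor: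
  assumes "split_mono C (h \<cdot> g)" "g \<in> Ar C" "h \<in> Ar C" "tgt C g = src C h"
  shows "split_mono C g"
proof -
  obtain r where r: "r \<in> Ar C" "src C r = tgt C (h \<cdot> g)" "tgt C r = src C (h \<cdot> g)"
    "r \<cdot> (h \<cdot> g) = ident C (src C (h \<cdot> g))"
    using assms(1) by (rule split_monoE)
  then show ?thesis using assms(2-4)
    by (intro split_monoI[of "r \<cdot> h"]) (auto simp: cmp_cmp)
qed

lemma split_mono_cmp:
  assumes "split_mono C f" "split_mono C g" "tgt C f = src C g"
  shows "split_mono C (g \<cdot> f)"
proof -
  obtain r where r: "f \<in> Ar C" "r \<in> Ar C" "src C r = tgt C f" "tgt C r = src C f"
    "r \<cdot> f = ident C (src C f)"
    using assms(1) by (rule split_monoE)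
  obtain s where s: "g \<in> Ar C" "s \<in> Ar C" "src C s = tgt C g" "tgt C s = src C g"
    "s \<cdot> g = ident C (src C g)"
    using assms(2) by (rule split_monoE)
  have "(r \<cdot> s) \<cdot> (g \<cdot> f) = r \<cdot> ((s \<cdot> g) \<cdot> f)"
    using r(1-4) s(1-4) assms(3) by (simp add: cmp_cmp)
  then show ?thesis using r s assms(3) by (intro split_monoI[of "r \<cdot> s"]) auto
qed

section \<open>Isomorphisms and conjugation\<close>

lemma is_inverse_unique: "is_inverse C f g \<Longrightarrow> is_inverse C f h \<Longrightarrow> g = h"
  unfolding is_inverse_def by (metis HomD cmp_cmp cmp_ident)

lemma is_inverse_inverse_arrow: "is_iso C f \<Longrightarrow> is_inverse C f (inverse_arrow C f)"
  unfolding is_iso_def inverse_arrow_def by (metis is_inverse_unique theI')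

lemma inverse_simps [simp]:
  assumes "is_iso C f"
  shows "f \<in> Ar C" "inverse_arrow C f \<in> Ar C" "src C (inverse_arrow C f) = tgt C f"
    "tgt C (inverse_arrow C f) = src C f"
    "inverse_arrow C f \<cdot> f = ident C (src C f)" "f \<cdot> inverse_arrow C f = ident C (tgt C f)"
  using is_inverse_inverse_arrow[OF assms] by (auto simp: is_inverse_def Hom_iff)

lemma inverse_cancel [simp]:
  assumes "is_iso C f" "x \<in> Ar C"
  shows "tgt C x = src C f \<Longrightarrow> inverse_arrow C f \<cdot> (f \<cdot> x) = x"
    "tgt C x = tgt C f \<Longrightarrow> f \<cdot> (inverse_arrow C f \<cdot> x) = x"
  using assms by (simp_all add: cmp_cmp[symmetric])

lemma is_isoI: "f \<in> Ar C \<Longrightarrow> g \<in> Ar C \<Longrightarrow> src C g = tgt C f \<Longrightarrow> tgt C g = src C f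
    \<Longrightarrow> g \<cdot> f = ident C (src C f) \<Longrightarrow> f \<cdot> g = ident C (tgt C f) \<Longrightarrow> is_iso C f"
  unfolding is_iso_def is_inverse_def by (auto simp: Hom_iff)

lemma is_iso_inverse: "is_iso C f \<Longrightarrow> is_iso C (inverse_arrow C f)"
  by (rule is_isoI[of _ f]) auto

lemma is_iso_split_mono: "is_iso C f \<Longrightarrow> split_mono C f"
  by (rule split_monoI[of "inverse_arrow C f"]) auto

lemma is_iso_mono: "is_iso C f \<Longrightarrow> is_mono C f"
  by (simp add: is_iso_split_mono split_mono_mono)

lemma is_iso_epi: "is_iso C f \<Longrightarrow> is_epi C f"
proof (rule is_epiI)
  fix a b assume *: "is_iso C f" "a \<in> Ar C" "b \<in> Ar C" "src C a = tgt C f" "src C b = tgt C f"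
    "a \<cdot> f = b \<cdot> f"
  have "a = (a \<cdot> f) \<cdot> inverse_arrow C f" using *(1-5) by (simp add: cmp_cmp)
  also have "\<dots> = (b \<cdot> f) \<cdot> inverse_arrow C f" using *(6) by simp
  also have "\<dots> = b" using *(1-5) by (simp add: cmp_cmp)
  finally show "a = b" .
qed auto

lemma is_iso_cmp:
  assumes "is_iso C f" "is_iso C g" "tgt C f = src C g"
  shows "is_iso C (g \<cdot> f)"
  using assms by (intro is_isoI[of _ "inverse_arrow C f \<cdot> inverse_arrow C g"])
    (auto simp: cmp_cmp)

lemma inverse_move:
  assumes "is_iso C a" "x \<in> Ar C" "y \<in> Ar C" "tgt C x = src C a" "a \<cdot> x = y"
  shows "inverse_arrow C a \<cdot> y = x"
  using assms by (auto simp: cmp_cmp)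

text \<open>Every change of bracketing, order or unit factor in the later cancellation steps is a
  square of this kind.\<close>

lemma split_mono_conj:
  assumes "split_mono C g" "b \<cdot> g = g' \<cdot> a" "is_iso C a" "is_iso C b" "g' \<in> Ar C"
    "src C b = tgt C g" "tgt C b = tgt C g'" "src C a = src C g" "tgt C a = src C g'"
  shows "split_mono C g'"
proof -
  have g: "g \<in> Ar C" using assms(1) by (auto elim: split_monoE)
  have "g' = (g' \<cdot> a) \<cdot> inverse_arrow C a"
    using assms(3-) by (simp add: cmp_cmp)
  then have "g' = b \<cdot> (g \<cdot> inverse_arrow C a)"
    using assms(3-) g by (simp add: cmp_cmp flip: assms(2))
  moreover have "split_mono C (b \<cdot> (g \<cdot> inverse_arrow C a))"
    using assms g
    by (intro split_mono_cmp[OF split_mono_cmp] is_iso_split_mono[OF is_iso_inverse]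
        is_iso_split_mono[of b]) auto
  ultimately show ?thesis by simp
qed

section \<open>Inheritance along embeddings and coverings\<close>

lemma complemented_embeds:
  assumes "complemented C B" "embeds C A B"
  shows "complemented C A"
proof -
  obtain f where f: "f \<in> Ar C" "src C f = A" "tgt C f = B" "is_mono C f"
    using assms(2) by (auto simp: embeds_def Hom_iff)
  have "split_mono C m" if m: "is_mono C m" "tgt C m = A" for m
  \<comment> \<open>Followed by \<open>f\<close>, the mono \<open>m\<close> becomes a mono into
    \<open>B\<close>, which splits; a right factor of a split mono splits.\<close>
  proof (rule split_mono_right_factor)
    have "is_mono C (f \<cdot> m)" "tgt C (f \<cdot> m) = B"
      using is_mono_cmp[OF m(1) f(4)] m f by (auto simp: is_mono_Ar)
    then show "split_mono C (f \<cdot> m)" using assms(1) by (auto simp: complemented_def)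
  qed (use m f in \<open>auto simp: is_mono_Ar\<close>)
  then show ?thesis using f Ob_src_tgt(1) by (auto simp: complemented_def)
qed

lemma embeds_trans: "embeds C A B \<Longrightarrow> embeds C B D \<Longrightarrow> embeds C A D"
proof -
  assume "embeds C A B" "embeds C B D"
  then obtain f g where "f \<in> Hom C A B" "is_mono C f" "g \<in> Hom C B D" "is_mono C g"
    by (auto simp: embeds_def)
  then show ?thesis
    unfolding embeds_def by (intro bexI[of _ "g \<cdot> f"]) (auto simp: Hom_iff intro: is_mono_cmp)
qed

lemma covers_trans: "covers C A B \<Longrightarrow> covers C B D \<Longrightarrow> covers C A D"
proof -
  assume "covers C A B" "covers C B D"
  then obtain f g where "f \<in> Hom C A B" "is_epi C f" "g \<in> Hom C B D" "is_epi C g"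
    by (auto simp: covers_def)
  then show ?thesis
    unfolding covers_def by (intro bexI[of _ "g \<cdot> f"]) (auto simp: Hom_iff intro: is_epi_cmp)
qed

lemma embeds_refl: "A \<in> Ob C \<Longrightarrow> embeds C A A"
  unfolding embeds_def by (auto intro!: bexI[of _ "ident C A"] is_monoI simp: Hom_iff)

lemma covers_refl: "A \<in> Ob C \<Longrightarrow> covers C A A"
  unfolding covers_def by (auto intro!: bexI[of _ "ident C A"] is_epiI simp: Hom_iff)

lemma embeds_iso: "is_iso C f \<Longrightarrow> src C f = A \<Longrightarrow> tgt C f = B \<Longrightarrow> embeds C A B"
  unfolding embeds_def by (auto intro!: bexI[of _ f] is_iso_mono simp: Hom_iff)

lemma embeds_iso': "is_iso C f \<Longrightarrow> src C f = A \<Longrightarrow> tgt C f = B \<Longrightarrow> embeds C B A"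
  by (rule embeds_iso[of "inverse_arrow C f"]) (auto simp: is_iso_inverse)

end

section \<open>Semisimple objects in abelian categories\<close>

lemma (in abelian_group) add_eq_right_imp_zero:
  "x \<oplus> y = y \<Longrightarrow> x \<in> carrier G \<Longrightarrow> y \<in> carrier G \<Longrightarrow> x = \<zero>"
  by (metis a_assoc a_inv_closed r_neg r_zero)

lemma (in abelian_group) minus_add_cancel:
  "x \<in> carrier G \<Longrightarrow> y \<in> carrier G \<Longrightarrow> (x \<ominus> y) \<oplus> y = x"
  by (simp add: a_minus_def a_assoc l_neg)

context linear_category
begin

section \<open>Hom spaces as abelian groups\<close>

lemma hom_space_abelian_group: "X \<in> Ob C \<Longrightarrow> Y \<in> Ob C \<Longrightarrow> abelian_group (hom_space C X Y)"
  using hom_vectorspace unfolding vectorspace_def module_def by blast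

lemmas hom_space_abelian_monoid = abelian_group.axioms(1)[OF hom_space_abelian_group]

lemma hom_space_sel [simp]: "carrier (hom_space C X Y) = Hom C X Y"
  "zero (hom_space C X Y) = arr_zero C X Y" "add (hom_space C X Y) = arr_add C"
  by (simp_all add: hom_space_def)

lemma add_closed: "f \<in> Hom C X Y \<Longrightarrow> g \<in> Hom C X Y \<Longrightarrow> arr_add C f g \<in> Hom C X Y"
  using abelian_monoid.a_closed[OF hom_space_abelian_monoid, of X Y f g]
    HomD(4,5)[of f X Y] by simp

lemma arr_zero_closed: "X \<in> Ob C \<Longrightarrow> Y \<in> Ob C \<Longrightarrow> arr_zero C X Y \<in> Hom C X Y"
  using abelian_monoid.zero_closed[OF hom_space_abelian_monoid, of X Y]
  by simp

lemma add_simps [simp]: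
  assumes "f \<in> Ar C" "g \<in> Ar C" "src C g = src C f" "tgt C g = tgt C f"
  shows "arr_add C f g \<in> Ar C" "src C (arr_add C f g) = src C f" "tgt C (arr_add C f g) = tgt C f"
  using add_closed[of f "src C f" "tgt C f" g] assms by (auto simp: Hom_iff)

lemma zero_simps [simp]: "X \<in> Ob C \<Longrightarrow> Y \<in> Ob C \<Longrightarrow> arr_zero C X Y \<in> Ar C"
  "X \<in> Ob C \<Longrightarrow> Y \<in> Ob C \<Longrightarrow> src C (arr_zero C X Y) = X"
  "X \<in> Ob C \<Longrightarrow> Y \<in> Ob C \<Longrightarrow> tgt C (arr_zero C X Y) = Y"
  using arr_zero_closed by (auto simp: Hom_iff)

lemma add_zero [simp]:
  assumes "f \<in> Ar C" "src C f = X" "tgt C f = Y"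
  shows "arr_add C f (arr_zero C X Y) = f" "arr_add C (arr_zero C X Y) f = f"
proof -
  have *: "abelian_monoid (hom_space C X Y)"
    using assms hom_space_abelian_monoid Ob_src_tgt by blast
  show "arr_add C f (arr_zero C X Y) = f" "arr_add C (arr_zero C X Y) f = f"
    using abelian_monoid.r_zero[OF *, of f] abelian_monoid.l_zero[OF *, of f] assms
    by (auto simp: Hom_iff)
qed

lemma add_eq_right_imp_zero:
  assumes "arr_add C f g = g" "f \<in> Hom C X Y" "g \<in> Hom C X Y"
  shows "f = arr_zero C X Y"
  using abelian_group.add_eq_right_imp_zero[OF hom_space_abelian_group, of X Y f g] assms
    HomD(4,5)[OF assms(2)] by simp

text \<open>Subtraction in the form in which it is used later: \<open>d\<close> is named by an
  equation between sums, so no negative arrows appear in the calculations.\<close>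

lemma difference:
  assumes "f \<in> Hom C X Y" "g \<in> Hom C X Y"
  obtains d where "d \<in> Hom C X Y" "arr_add C d g = f"
proof -
  have *: "abelian_group (hom_space C X Y)"
    using assms hom_space_abelian_group HomD(4,5) by blast
  show ?thesis
    using that[of "f \<ominus>\<^bsub>hom_space C X Y\<^esub> g"] assms abelian_group.minus_closed[OF *, of f g]
      abelian_group.minus_add_cancel[OF *, of f g]
    by simp
qed

lemma cmp_add1:
  assumes "f \<in> Ar C" "f' \<in> Ar C" "g \<in> Ar C" "src C f' = src C f" "tgt C f' = tgt C f"
    "src C g = tgt C f"
  shows "g \<cdot> arr_add C f f' = arr_add C (g \<cdot> f) (g \<cdot> f')"
  using cmp_add_right[of f "src C f" "tgt C f" f' g "tgt C g"] assms by (auto simp: Hom_iff)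

lemma cmp_add2:
  assumes "f \<in> Ar C" "g \<in> Ar C" "g' \<in> Ar C" "src C g = tgt C f" "src C g' = tgt C f"
    "tgt C g' = tgt C g"
  shows "arr_add C g g' \<cdot> f = arr_add C (g \<cdot> f) (g' \<cdot> f)"
  using cmp_add_left[of f "src C f" "tgt C f" g "tgt C g" g'] assms by (auto simp: Hom_iff)

lemmas cmp_add = cmp_add1 cmp_add2

text \<open>By bilinearity the composite equals its own double, and in a group only zero
  does.\<close>

lemma cmp_zero [simp]:
  assumes "f \<in> Ar C" "X \<in> Ob C" "src C f = Y"
  shows "f \<cdot> arr_zero C X Y = arr_zero C X (tgt C f)"
proof (rule add_eq_right_imp_zero)
  have "Y \<in> Ob C" using assms by auto
  then show "arr_add C (f \<cdot> arr_zero C X Y) (f \<cdot> arr_zero C X Y) = f \<cdot> arr_zero C X Y"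
    using assms by (subst cmp_add(1)[symmetric]) auto
qed (use assms in \<open>auto simp: Hom_iff\<close>)

lemma zero_cmp [simp]:
  assumes "f \<in> Ar C" "Z \<in> Ob C" "tgt C f = Y"
  shows "arr_zero C Y Z \<cdot> f = arr_zero C (src C f) Z"
proof (rule add_eq_right_imp_zero)
  have "Y \<in> Ob C" using assms by auto
  then show "arr_add C (arr_zero C Y Z \<cdot> f) (arr_zero C Y Z \<cdot> f) = arr_zero C Y Z \<cdot> f"
    using assms by (subst cmp_add(2)[symmetric]) auto
qed (use assms in \<open>auto simp: Hom_iff\<close>)

section \<open>Zero objects, kernels and cokernels\<close>

lemma is_zero_object_iff:
  assumes "Z \<in> Ob C"
  shows "is_zero_object C Z \<longleftrightarrow> ident C Z = arr_zero C Z Z"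
proof
  assume "is_zero_object C Z"
  then have "\<exists>!f. f \<in> Hom C Z Z" using assms by (auto simp: is_zero_object_def)
  then show "ident C Z = arr_zero C Z Z" using assms by (auto simp: Hom_iff)
next
  assume *: "ident C Z = arr_zero C Z Z"
  have "f = arr_zero C X Z" if "f \<in> Hom C X Z" for f X
    using that cmp_ident(2)[of f Z] assms * zero_cmp[of f Z Z] by (auto simp: Hom_iff simp del: cmp_ident)
  moreover have "f = arr_zero C Z X" if "f \<in> Hom C Z X" for f X
    using that cmp_ident(1)[of f Z] assms * cmp_zero[of f Z Z] by (auto simp: Hom_iff simp del: cmp_ident)
  ultimately show "is_zero_object C Z"
    unfolding is_zero_object_def using assms arr_zero_closed by metis
qed

text \<open>Two arrows that agree after \<open>f\<close> have a difference that vanishes after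
  \<open>f\<close>, so cancellation against zero suffices.\<close>

lemma is_epiI_zero:
  assumes "f \<in> Ar C"
    and "\<And>g. g \<in> Ar C \<Longrightarrow> src C g = tgt C f \<Longrightarrow> g \<cdot> f = arr_zero C (src C f) (tgt C g)
      \<Longrightarrow> g = arr_zero C (tgt C f) (tgt C g)"
  shows "is_epi C f"
proof (rule is_epiI[OF assms(1)])
  fix g h assume *: "g \<in> Ar C" "h \<in> Ar C" "src C g = tgt C f" "src C h = tgt C f"
    "tgt C g = tgt C h" "g \<cdot> f = h \<cdot> f"
  obtain d where d: "d \<in> Hom C (tgt C f) (tgt C h)" "arr_add C d h = g"
    using difference[of g "tgt C f" "tgt C h" h] * by (auto simp: Hom_iff)
  have "arr_add C (d \<cdot> f) (h \<cdot> f) = arr_add C d h \<cdot> f"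
    by (rule cmp_add2[symmetric]) (use d(1) * assms(1) in \<open>auto simp: Hom_iff\<close>)
  then have "arr_add C (d \<cdot> f) (h \<cdot> f) = h \<cdot> f" using d(2) *(6) by simp
  then have "d \<cdot> f = arr_zero C (src C f) (tgt C h)"
    using d * assms(1) by (intro add_eq_right_imp_zero[where g = "h \<cdot> f"]) (auto simp: Hom_iff)
  then have "d = arr_zero C (tgt C f) (tgt C h)" using assms(2)[of d] d by (auto simp: Hom_iff)
  then show "g = h" using d * by auto
qed

lemma is_kernelD:
  assumes "is_kernel C f k"
  shows "f \<in> Ar C" "k \<in> Ar C" "tgt C k = src C f" "f \<cdot> k = arr_zero C (src C k) (tgt C f)"
  using assms by (auto simp: is_kernel_def)

lemma is_kernel_factor:
  assumes "is_kernel C f k" "h \<in> Ar C" "tgt C h = src C f" "f \<cdot> h = arr_zero C (src C h) (tgt C f)"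
  obtains u where "u \<in> Ar C" "src C u = src C h" "tgt C u = src C k" "k \<cdot> u = h"
  using assms that unfolding is_kernel_def by (metis HomD(1-3) Hom_self Ob_src_tgt(1))

lemma is_kernel_mono:
  assumes "is_kernel C f k"
  shows "is_mono C k"
proof (rule is_monoI)
  note k = is_kernelD[OF assms]
  fix a b assume *: "a \<in> Ar C" "b \<in> Ar C" "tgt C a = src C k" "tgt C b = src C k"
    "src C a = src C b" "k \<cdot> a = k \<cdot> b"
  have "f \<cdot> (k \<cdot> b) = arr_zero C (src C b) (tgt C f)"
    using k * cmp_reassoc[OF k(4), of b] by simp
  then have "\<exists>!u. u \<in> Hom C (src C b) (src C k) \<and> k \<cdot> u = k \<cdot> b"
    using assms * k by (auto simp: is_kernel_def Hom_iff)
  then show "a = b" using * by (auto simp: Hom_iff)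
qed (use assms in \<open>auto simp: is_kernel_def\<close>)

lemma is_cokernelD:
  assumes "is_cokernel C f q"
  shows "f \<in> Ar C" "q \<in> Ar C" "src C q = tgt C f" "q \<cdot> f = arr_zero C (src C f) (tgt C q)"
  using assms by (auto simp: is_cokernel_def)

lemma is_cokernel_factor:
  assumes "is_cokernel C f q" "h \<in> Ar C" "src C h = tgt C f" "h \<cdot> f = arr_zero C (src C f) (tgt C h)"
  obtains u where "u \<in> Ar C" "src C u = tgt C q" "tgt C u = tgt C h" "u \<cdot> q = h"
  using assms that unfolding is_cokernel_def by (metis HomD(1-3) Hom_self Ob_src_tgt(2))

lemma is_cokernel_epi:
  assumes "is_cokernel C f q"
  shows "is_epi C q"
proof (rule is_epiI)
  note q = is_cokernelD[OF assms]
  fix a b assume *: "a \<in> Ar C" "b \<in> Ar C" "src C a = tgt C q" "src C b = tgt C q"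
    "tgt C a = tgt C b" "a \<cdot> q = b \<cdot> q"
  have "(b \<cdot> q) \<cdot> f = arr_zero C (src C f) (tgt C b)"
    using q * by (simp add: cmp_cmp)
  then have "\<exists>!u. u \<in> Hom C (tgt C q) (tgt C b) \<and> u \<cdot> q = b \<cdot> q"
    using assms * q by (auto simp: is_cokernel_def Hom_iff)
  then show "a = b" using * by (auto simp: Hom_iff)
qed (use assms in \<open>auto simp: is_cokernel_def\<close>)

section \<open>Finite sums of arrows\<close>

lemma finsum_insert_hom:
  assumes "X \<in> Ob C" "Y \<in> Ob C" "finite F" "i \<notin> F" "\<And>j. j \<in> insert i F \<Longrightarrow> g j \<in> Hom C X Y"
  shows "finsum (hom_space C X Y) g (insert i F) = arr_add C (g i) (finsum (hom_space C X Y) g F)"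
  using abelian_monoid.finsum_insert[OF hom_space_abelian_monoid, of X Y F i g] assms
  by (auto simp: Pi_def)

lemma finsum_empty_hom: "X \<in> Ob C \<Longrightarrow> Y \<in> Ob C \<Longrightarrow> finsum (hom_space C X Y) g {} = arr_zero C X Y"
  using abelian_monoid.finsum_empty[OF hom_space_abelian_monoid] by simp

lemma finsum_closed_hom:
  assumes "X \<in> Ob C" "Y \<in> Ob C" "finite F" "\<And>j. j \<in> F \<Longrightarrow> g j \<in> Hom C X Y"
  shows "finsum (hom_space C X Y) g F \<in> Hom C X Y"
  using abelian_monoid.finsum_closed[OF hom_space_abelian_monoid, of X Y g F] assms
  by (auto simp: Pi_def)

lemma finsum_sandwich:
  assumes "finite F" "a \<in> Hom C X Y" "b \<in> Hom C Z W" "\<And>j. j \<in> F \<Longrightarrow> g j \<in> Hom C Y Z"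
  shows "finsum (hom_space C X W) (\<lambda>j. b \<cdot> (g j \<cdot> a)) F = b \<cdot> (finsum (hom_space C Y Z) g F \<cdot> a)"
  using assms(1,4)
proof (induction F rule: finite_induct)
  case empty
  then show ?case using assms(2,3) HomD(4,5)[OF assms(2)] HomD(4,5)[OF assms(3)]
    by (simp add: finsum_empty_hom Hom_iff)
next
  case (insert i F)
  note Obs = HomD(4,5)[OF assms(2)] HomD(4,5)[OF assms(3)]
  have s: "finsum (hom_space C Y Z) g F \<in> Hom C Y Z" "g i \<in> Hom C Y Z"
    using insert Obs by (auto intro: finsum_closed_hom)
  have "b \<cdot> (g j \<cdot> a) \<in> Hom C X W" if "j \<in> insert i F" for j
    using insert(4)[OF that] assms(2,3) by (auto simp: Hom_iff)
  then have "finsum (hom_space C X W) (\<lambda>j. b \<cdot> (g j \<cdot> a)) (insert i F) =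
      arr_add C (b \<cdot> (g i \<cdot> a)) (b \<cdot> (finsum (hom_space C Y Z) g F \<cdot> a))"
    using insert Obs by (subst finsum_insert_hom) auto
  also have "\<dots> = b \<cdot> (arr_add C (g i) (finsum (hom_space C Y Z) g F) \<cdot> a)"
    using s assms(2,3) by (auto simp: Hom_iff cmp_add)
  also have "\<dots> = b \<cdot> (finsum (hom_space C Y Z) g (insert i F) \<cdot> a)"
    using insert Obs by (subst finsum_insert_hom) auto
  finally show ?case .
qed

text \<open>Composing the resolution of the identity with \<open>m\<close> writes \<open>m\<close>
  as a sum of arrows \<open>\<iota> i \<cdot> (\<pi> i \<cdot> m)\<close>, all of them zero. The
  induction runs over subsets of the index set, as partial sums are not identities.\<close>

lemma direct_sum_jointly_monic:
  fixes n :: nat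
  assumes "\<forall>i<n. \<iota> i \<in> Hom C (S i) X \<and> \<pi> i \<in> Hom C X (S i)" "X \<in> Ob C"
    and "finsum (hom_space C X X) (\<lambda>i. \<iota> i \<cdot> \<pi> i) {..<n} = ident C X"
    and "m \<in> Hom C A X" "\<forall>i<n. \<pi> i \<cdot> m = arr_zero C A (S i)"
  shows "m = arr_zero C A X"
proof -
  have h: "\<iota> i \<cdot> \<pi> i \<in> Hom C X X" if "i < n" for i
    using assms(1) that by (auto simp: Hom_iff)
  note A = HomD[OF assms(4)]
  have "F \<subseteq> {..<n} \<Longrightarrow> finsum (hom_space C X X) (\<lambda>i. \<iota> i \<cdot> \<pi> i) F \<cdot> m = arr_zero C A X"
    if "finite F" for F
    using that
  proof (induction F rule: finite_induct)
    case empty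
    then show ?case using A assms(2) by (simp add: finsum_empty_hom)
  next
    case (insert i F)
    then have i: "i < n" by auto
    have s: "finsum (hom_space C X X) (\<lambda>i. \<iota> i \<cdot> \<pi> i) F \<in> Hom C X X"
      using insert h assms(2) by (intro finsum_closed_hom) auto
    have "(\<iota> i \<cdot> \<pi> i) \<cdot> m = \<iota> i \<cdot> (\<pi> i \<cdot> m)"
      using assms(1) i A by (intro cmp_cmp) (auto simp: Hom_iff)
    also have "\<dots> = arr_zero C A X"
      using assms(1,5) i A by (auto simp: Hom_iff)
    finally have "(\<iota> i \<cdot> \<pi> i) \<cdot> m = arr_zero C A X" .
    then show ?case using insert s h[OF i] A assms(2) h
      by (subst finsum_insert_hom) (auto simp: cmp_add Hom_iff)
  qed
  from this[of "{..<n}"] have "ident C X \<cdot> m = arr_zero C A X"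
    unfolding assms(3) by simp
  then show ?thesis using A by simp
qed

end

section \<open>Splitting of exact sequences; semisimple means complemented\<close>

context abelian_linear_category
begin

text \<open>Let \<open>d\<close> be the identity minus \<open>k \<cdot> r\<close>. The epi
  \<open>e\<close> is a cokernel of some \<open>f\<close>, and \<open>f\<close> factors through
  \<open>k\<close>, so \<open>d\<close> kills \<open>f\<close> and hence equals
  \<open>s \<cdot> e\<close> for some \<open>s\<close>. Since \<open>e\<close> kills
  \<open>k\<close>, also \<open>e \<cdot> s \<cdot> e = e\<close>, and \<open>e\<close> can be
  cancelled on the right.\<close>

lemma split_kernel_imp_section:
  assumes "is_epi C e" "is_kernel C e k" "r \<in> Hom C (src C e) (src C k)" "r \<cdot> k = ident C (src C k)"
  obtains s where "s \<in> Hom C (tgt C e) (src C e)" "e \<cdot> s = ident C (tgt C e)"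
    "arr_add C (s \<cdot> e) (k \<cdot> r) = ident C (src C e)"
proof -
  note [simp] = is_kernelD[OF assms(2)] HomD(1-3)[OF assms(3)]
  obtain f where f: "is_cokernel C f e" using epi_is_cokernel[OF assms(1)] by auto
  note [simp] = is_cokernelD(1)[OF f] is_cokernelD(3)[OF f, symmetric]
  have ef: "e \<cdot> f = arr_zero C (src C f) (tgt C e)" by (rule is_cokernelD(4)[OF f])
  obtain u where [simp]: "u \<in> Ar C" "src C u = src C f" "tgt C u = src C k" and ku: "k \<cdot> u = f"
    using is_kernel_factor[OF assms(2) _ _ ef] by auto
  obtain d where d: "d \<in> Hom C (src C e) (src C e)" "arr_add C d (k \<cdot> r) = ident C (src C e)"
    using difference[of "ident C (src C e)" "src C e" "src C e" "k \<cdot> r"] by (auto simp: Hom_iff)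
  note [simp] = HomD(1-3)[OF d(1)]
  have krf: "(k \<cdot> r) \<cdot> f = f"
    using cmp_reassoc[OF assms(4), of u] by (simp add: ku[symmetric] cmp_cmp)
  have "arr_add C (d \<cdot> f) f = arr_add C d (k \<cdot> r) \<cdot> f"
    using krf by (simp add: cmp_add)
  then have "arr_add C (d \<cdot> f) f = f" by (simp add: d(2))
  then have "d \<cdot> f = arr_zero C (src C f) (src C e)"
    by (rule add_eq_right_imp_zero) (auto simp: Hom_iff)
  then obtain s where [simp]: "s \<in> Ar C" "src C s = tgt C e" "tgt C s = src C e" and se: "s \<cdot> e = d"
    using is_cokernel_factor[OF f, of d] by auto
  have "e \<cdot> d = arr_add C (e \<cdot> d) (e \<cdot> (k \<cdot> r))"
    using cmp_reassoc[OF is_kernelD(4)[OF assms(2)], of r] by simp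
  also have "\<dots> = e \<cdot> arr_add C d (k \<cdot> r)" by (simp add: cmp_add)
  finally have "e \<cdot> d = e" by (simp add: d(2))
  then have "(e \<cdot> s) \<cdot> e = ident C (tgt C e) \<cdot> e" by (simp add: cmp_cmp se)
  then have "e \<cdot> s = ident C (tgt C e)" by (rule is_epiD[OF assms(1)]) auto
  then show ?thesis using that[of s] d(2) se by (auto simp: Hom_iff)
qed

lemma complemented_split_epi:
  assumes "complemented C X" "is_epi C e" "src C e = X"
  shows "split_epi C e"
proof -
  obtain k where k: "is_kernel C e k" using kernels_exist is_epi_Ar[OF assms(2)] by blast
  then have "split_mono C k"
    using is_kernel_mono[OF k] is_kernelD(3)[OF k] assms by (auto simp: complemented_def)
  then obtain r where "r \<in> Hom C (src C e) (src C k)" "r \<cdot> k = ident C (src C k)"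
    using is_kernelD(3)[OF k] by (auto elim!: split_monoE simp: Hom_iff)
  then show ?thesis using split_kernel_imp_section[OF assms(2) k] is_epi_Ar[OF assms(2)]
    unfolding split_epi_def by metis
qed

text \<open>A section of the epi embeds \<open>Q\<close> into \<open>X\<close>, so quotients reduce
  to subobjects.\<close>

lemma complemented_covers:
  assumes "complemented C X" "covers C X Q"
  shows "complemented C Q"
proof -
  obtain e where e: "is_epi C e" "src C e = X" "tgt C e = Q"
    using assms(2) by (auto simp: covers_def Hom_iff)
  obtain s where s: "e \<in> Ar C" "s \<in> Ar C" "src C s = tgt C e" "tgt C s = src C e"
    "e \<cdot> s = ident C (tgt C e)"
    using complemented_split_epi[OF assms(1) e(1,2)] by (rule split_epiE)
  then have "split_mono C s" by (intro split_monoI[of e]) auto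
  then have "embeds C Q X" unfolding embeds_def using split_mono_mono[of s] s e
    by (intro bexI[of _ s]) (auto simp: Hom_iff)
  then show ?thesis using complemented_embeds assms(1) by blast
qed

text \<open>The image of \<open>p\<close> is formed as the kernel \<open>i\<close> of its cokernel
  \<open>q\<close>. It is not zero because \<open>p\<close> factors through it, so simplicity makes
  \<open>i\<close> an isomorphism. Then \<open>q \<cdot> i = 0\<close> forces \<open>q = 0\<close>,
  and every arrow killing \<open>p\<close> factors through \<open>q\<close>.\<close>

lemma nonzero_into_simple_epi:
  assumes "is_simple C S" "p \<in> Hom C A S" "p \<noteq> arr_zero C A S"
  shows "is_epi C p"
proof -
  note [simp] = HomD(1-3)[OF assms(2)] HomD(4,5)[OF assms(2)]
  obtain q where q: "is_cokernel C p q" using cokernels_exist[of p] by auto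
  note [simp] = is_cokernelD[OF q]
  obtain i where i: "is_kernel C q i" using kernels_exist[of q] by auto
  note [simp] = is_kernelD[OF i]
  obtain u where u: "u \<in> Ar C" "src C u = A" "tgt C u = src C i" "i \<cdot> u = p"
    using is_kernel_factor[OF i, of p] by auto
  have "\<not> is_zero_object C (src C i)"
  proof
    assume "is_zero_object C (src C i)"
    then have "ident C (src C i) = arr_zero C (src C i) (src C i)" by (simp add: is_zero_object_iff)
    then have "u = arr_zero C (src C i) (src C i) \<cdot> u" using u by (metis cmp_ident(2))
    then have "u = arr_zero C A (src C i)" using u by simp
    then show False using assms(3) u by simp
  qed
  then have "is_iso C i"
    using assms(1) is_kernel_mono[OF i] by (auto simp: is_simple_def)
  then have q0: "q = arr_zero C S (tgt C q)"
    using is_epiD[OF is_iso_epi, of i q "arr_zero C S (tgt C q)"] by auto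
  show ?thesis
  proof (rule is_epiI_zero)
    fix g assume g: "g \<in> Ar C" "src C g = tgt C p" "g \<cdot> p = arr_zero C (src C p) (tgt C g)"
    then obtain v where v: "v \<in> Ar C" "src C v = tgt C q" "tgt C v = tgt C g" "v \<cdot> q = g"
      using is_cokernel_factor[OF q, of g] by auto
    then have "g = v \<cdot> arr_zero C S (tgt C q)" using q0 by simp
    also have "\<dots> = arr_zero C S (tgt C g)" using v by simp
    finally show "g = arr_zero C (tgt C p) (tgt C g)" by simp
  qed simp
qed

text \<open>Induction on a bound \<open>j\<close> such that the components of \<open>m\<close> at
  the indices from \<open>j\<close> on vanish. If the last remaining component \<open>p\<close> of
  \<open>m\<close> is nonzero it is epi, and on its kernel \<open>k\<close> it vanishes too, so
  \<open>m \<cdot> k\<close> has a retraction \<open>r\<close> by induction. Then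
  \<open>r \<cdot> m\<close> retracts \<open>k\<close>, which gives a section \<open>s\<close> of
  \<open>p\<close>, and the two pieces combine to the retraction
  \<open>s \<cdot> \<pi> j + k \<cdot> r\<close> of \<open>m\<close>.\<close>

lemma semisimple_imp_complemented:
  assumes "is_semisimple C X"
  shows "complemented C X"
proof -
  obtain n :: nat and S :: "nat \<Rightarrow> 'o" and \<iota> \<pi> :: "nat \<Rightarrow> 'a" where simple: "\<forall>i<n. is_simple C (S i)" and X: "X \<in> Ob C"
    and h: "\<forall>i<n. \<iota> i \<in> Hom C (S i) X \<and> \<pi> i \<in> Hom C X (S i)"
    and sum: "finsum (hom_space C X X) (\<lambda>i. \<iota> i \<cdot> \<pi> i) {..<n} = ident C X"
    using assms unfolding is_semisimple_def is_direct_sum_def by (elim exE conjE) (rule that)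
  have "split_mono C m"
    if "j \<le> n" "is_mono C m" "tgt C m = X" "\<forall>i. j \<le> i \<and> i < n \<longrightarrow> \<pi> i \<cdot> m = arr_zero C (src C m) (S i)"
    for j m
    using that
  proof (induction j arbitrary: m)
    case 0
    then have m: "m \<in> Ar C" "m \<in> Hom C (src C m) X" by (auto simp: is_mono_Ar Hom_iff)
    then have m0: "m = arr_zero C (src C m) X"
      using direct_sum_jointly_monic[OF h X sum m(2)] 0 by auto
    \<comment> \<open>A mono that is zero has a zero source, and then the zero arrow back is a
      retraction.\<close>
    have "m \<cdot> arr_zero C (src C m) (src C m) = m \<cdot> ident C (src C m)"
      using m 0(3) m0[symmetric] by simp
    then have "arr_zero C (src C m) (src C m) = ident C (src C m)"
      by (rule is_monoD[OF 0(2)]) (use m in auto)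
    then show ?case using m X 0(3)
      by (intro split_monoI[of "arr_zero C X (src C m)"]) auto
  next
    case (Suc j)
    then have m: "m \<in> Ar C" "tgt C m = X" "j < n" by (auto simp: is_mono_Ar)
    define p where "p = \<pi> j \<cdot> m"
    have \<pi>j: "\<pi> j \<in> Ar C" "src C (\<pi> j) = X" "tgt C (\<pi> j) = S j" using h m by (auto simp: Hom_iff)
    then have p: "p \<in> Hom C (src C m) (S j)" using m by (auto simp: p_def Hom_iff)
    show ?case
    proof (cases "p = arr_zero C (src C m) (S j)")
      case True
      then have "\<pi> i \<cdot> m = arr_zero C (src C m) (S i)" if "j \<le> i" "i < n" for i
        using Suc(5) that by (cases "i = j") (auto simp: p_def)
      then show ?thesis using Suc(1)[of m] m Suc(3) by auto
    next
      case False
      then have e: "is_epi C p" using nonzero_into_simple_epi p simple m by blast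
      obtain k where k: "is_kernel C p k" using kernels_exist is_epi_Ar[OF e] by blast
      note kD = is_kernelD[OF k] HomD[OF p]
      have mk: "is_mono C (m \<cdot> k)" using kD is_mono_cmp[OF is_kernel_mono[OF k] Suc(3)] by simp
      have "\<pi> i \<cdot> (m \<cdot> k) = arr_zero C (src C (m \<cdot> k)) (S i)" if "j \<le> i" "i < n" for i
      proof -
        have \<pi>i: "\<pi> i \<in> Ar C" "src C (\<pi> i) = X" "tgt C (\<pi> i) = S i" "S i \<in> Ob C"
          using h that HomD[of "\<pi> i" X "S i"] by auto
        show ?thesis
        proof (cases "i = j")
          case True
          then show ?thesis using kD m \<pi>j by (simp add: p_def cmp_cmp)
        next
          case False
          then have "\<pi> i \<cdot> m = arr_zero C (src C m) (S i)" using Suc(5) that by auto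
          from cmp_reassoc[OF this, of k] show ?thesis using kD m \<pi>i by auto
        qed
      qed
      then have "split_mono C (m \<cdot> k)" using Suc(1)[of "m \<cdot> k"] mk m kD by auto
      then obtain r where r: "r \<in> Ar C" "src C r = X" "tgt C r = src C k" "r \<cdot> (m \<cdot> k) = ident C (src C k)"
        using kD m by (auto elim!: split_monoE)
      obtain s where s: "s \<in> Hom C (tgt C p) (src C p)" "arr_add C (s \<cdot> p) (k \<cdot> (r \<cdot> m)) = ident C (src C p)"
        using split_kernel_imp_section[OF e k, of "r \<cdot> m"] r kD m by (auto simp: Hom_iff cmp_cmp)
      have "arr_add C (s \<cdot> \<pi> j) (k \<cdot> r) \<cdot> m = ident C (src C m)"
        using s r kD m \<pi>j by (subst cmp_add(2)) (auto simp: Hom_iff cmp_cmp p_def)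
      then show ?thesis using s r kD m \<pi>j
        by (intro split_monoI[of "arr_add C (s \<cdot> \<pi> j) (k \<cdot> r)"]) (auto simp: Hom_iff)
    qed
  qed
  note partial = this
  have "split_mono C m" if "is_mono C m" "tgt C m = X" for m
    by (rule partial[of n]) (use that in auto)
  then show ?thesis using X by (auto simp: complemented_def)
qed

lemma semisimple_extension:
  fixes Y Q X :: 'o
  assumes "is_semisimple C Y" "is_simple C Q"
    and "j \<in> Hom C Y X" "r \<in> Hom C X Y" "s \<in> Hom C Q X" "q \<in> Hom C X Q"
    and "r \<cdot> j = ident C Y" "q \<cdot> s = ident C Q" "q \<cdot> j = arr_zero C Y Q" "r \<cdot> s = arr_zero C Q Y"
    and "arr_add C (s \<cdot> q) (j \<cdot> r) = ident C X"
  shows "is_semisimple C X"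
proof -
  obtain n :: nat and S :: "nat \<Rightarrow> 'o" and \<iota> \<pi> :: "nat \<Rightarrow> 'a" where simple: "\<forall>i<n. is_simple C (S i)" and "Y \<in> Ob C"
    and h: "\<forall>i<n. \<iota> i \<in> Hom C (S i) Y \<and> \<pi> i \<in> Hom C Y (S i)"
    and orth: "\<forall>i<n. \<forall>j<n. \<pi> i \<cdot> \<iota> j = (if i = j then ident C (S i) else arr_zero C (S j) (S i))"
    and sum: "finsum (hom_space C Y Y) (\<lambda>i. \<iota> i \<cdot> \<pi> i) {..<n} = ident C Y"
    using assms(1) unfolding is_semisimple_def is_direct_sum_def by (elim exE conjE) (rule that)
  note [simp] = HomD[OF assms(3)] HomD[OF assms(4)] HomD[OF assms(5)] HomD[OF assms(6)]
  \<comment> \<open>The new simple summand gets index \<open>n\<close>; of the indices sent to the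
    second branch only this one lies below \<open>Suc n\<close>.\<close>
  define S' where "S' = (\<lambda>i. if i < n then S i else Q)"
  define \<iota>' where "\<iota>' = (\<lambda>i. if i < n then j \<cdot> \<iota> i else s)"
  define \<pi>' where "\<pi>' = (\<lambda>i. if i < n then \<pi> i \<cdot> r else q)"
  have [simp]: "\<iota> i \<in> Ar C" "src C (\<iota> i) = S i" "tgt C (\<iota> i) = Y" "\<pi> i \<in> Ar C" "src C (\<pi> i) = Y"
    "tgt C (\<pi> i) = S i" "S i \<in> Ob C" if "i < n" for i
    using h that HomD[of "\<iota> i" "S i" Y] HomD[of "\<pi> i" Y "S i"] by auto
  have h': "\<iota>' i \<in> Hom C (S' i) X" "\<pi>' i \<in> Hom C X (S' i)" if "i < Suc n" for i
    using that by (auto simp: \<iota>'_def \<pi>'_def S'_def Hom_iff)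
  have orth': "\<pi>' i \<cdot> \<iota>' k = (if i = k then ident C (S' i) else arr_zero C (S' k) (S' i))"
    if "i < Suc n" "k < Suc n" for i k
  proof -
    have 1: "(\<pi> i \<cdot> r) \<cdot> (j \<cdot> \<iota> k) = \<pi> i \<cdot> \<iota> k" if "i < n" "k < n"
      using that cmp_reassoc[OF assms(7), of "\<iota> k"] by (simp add: cmp_cmp)
    have 2: "(\<pi> i \<cdot> r) \<cdot> s = arr_zero C Q (S i)" if "i < n"
      using that assms(10) by (simp add: cmp_cmp)
    have 3: "q \<cdot> (j \<cdot> \<iota> k) = arr_zero C (S k) Q" if "k < n"
      using that cmp_reassoc[OF assms(9), of "\<iota> k"] by simp
    show ?thesis using that 1 2 3 orth assms(8)
      by (auto simp: \<iota>'_def \<pi>'_def S'_def)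
  qed
  have sum': "finsum (hom_space C X X) (\<lambda>i. \<iota>' i \<cdot> \<pi>' i) {..<Suc n} = ident C X"
  proof -
    have "finsum (hom_space C X X) (\<lambda>i. \<iota>' i \<cdot> \<pi>' i) {..<Suc n} =
      arr_add C (\<iota>' n \<cdot> \<pi>' n) (finsum (hom_space C X X) (\<lambda>i. \<iota>' i \<cdot> \<pi>' i) {..<n})"
      unfolding lessThan_Suc using cmp_closed[OF h'(2) h'(1)] by (intro finsum_insert_hom) auto
    also have "finsum (hom_space C X X) (\<lambda>i. \<iota>' i \<cdot> \<pi>' i) {..<n} =
      finsum (hom_space C X X) (\<lambda>i. j \<cdot> ((\<iota> i \<cdot> \<pi> i) \<cdot> r)) {..<n}"
      by (rule abelian_monoid.finsum_cong'[OF hom_space_abelian_monoid])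
        (auto simp: \<iota>'_def \<pi>'_def cmp_cmp Hom_iff)
    also have "\<dots> = j \<cdot> (finsum (hom_space C Y Y) (\<lambda>i. \<iota> i \<cdot> \<pi> i) {..<n} \<cdot> r)"
      by (rule finsum_sandwich) (use assms(3,4) in \<open>auto simp: Hom_iff\<close>)
    also have "\<dots> = j \<cdot> r" using sum by simp
    also have "\<iota>' n \<cdot> \<pi>' n = s \<cdot> q" by (simp add: \<iota>'_def \<pi>'_def)
    finally show ?thesis using assms(11) by simp
  qed
  have "is_direct_sum C (Suc n) S' X"
    unfolding is_direct_sum_def
  proof (intro conjI, goal_cases)
    case 3
    show ?case
      by (rule exI[of _ \<iota>'], rule exI[of _ \<pi>'], intro conjI allI impI; fact orth' sum' h')
  qed (simp_all add: S'_def)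
  moreover have "\<forall>i<Suc n. is_simple C (S' i)" using simple assms(2) by (auto simp: S'_def)
  ultimately show ?thesis unfolding is_semisimple_def by blast
qed

lemma semisimple_zero:
  assumes "is_zero_object C X"
  shows "is_semisimple C X"
proof -
  have "X \<in> Ob C" using assms by (auto simp: is_zero_object_def)
  then have "is_direct_sum C 0 S X" for S
    using assms by (simp add: is_direct_sum_def finsum_empty_hom is_zero_object_iff)
  then show ?thesis unfolding is_semisimple_def by blast
qed

text \<open>The filtration is used twice. Going down from \<open>X\<close>, every \<open>Y i\<close>
  is complemented, being a subobject of the next. Going up from zero, each inclusion therefore
  splits and adds its simple quotient as a direct summand.\<close>

lemma complemented_imp_semisimple:
  assumes "complemented C X" "has_finite_length C X"
  shows "is_semisimple C X"
proof -
  obtain n Y j where Y0: "is_zero_object C (Y 0)" and Yn: "Y n = X"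
    and step: "\<forall>i<n. j i \<in> Hom C (Y i) (Y (Suc i)) \<and> is_mono C (j i) \<and>
        (\<exists>q. is_cokernel C (j i) q \<and> is_simple C (tgt C q))"
    using assms(2) unfolding has_finite_length_def by (elim exE conjE) (rule that)
  have cr: "complemented C (Y i)" if "i \<le> n" for i
    using that
  proof (induction rule: inc_induct)
    case base then show ?case using Yn assms(1) by simp
  next
    case (step i)
    then show ?case using \<open>\<forall>i<n. j i \<in> _ \<and> _\<close> complemented_embeds unfolding embeds_def by blast
  qed
  have "is_semisimple C (Y i)" if "i \<le> n" for i
    using that
  proof (induction i)
    case 0 then show ?case using semisimple_zero Y0 by simp
  next
    case (Suc i)
    then obtain q where ji: "j i \<in> Hom C (Y i) (Y (Suc i))" "is_mono C (j i)"
      and q: "is_cokernel C (j i) q" "is_simple C (tgt C q)"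
      using step by (meson Suc_le_lessD)
    note [simp] = HomD[OF ji(1)] is_cokernelD[OF q(1)]
    have "split_mono C (j i)" using cr[of "Suc i"] Suc ji by (auto simp: complemented_def)
    then obtain r where [simp]: "r \<in> Ar C" "src C r = Y (Suc i)" "tgt C r = Y i"
      and rj: "r \<cdot> j i = ident C (Y i)"
      by (auto elim: split_monoE)
    have qe: "is_epi C q" using is_cokernel_epi q by blast
    \<comment> \<open>Here \<open>q\<close> is known as a cokernel of \<open>j i\<close>, not
      \<open>j i\<close> as a kernel of \<open>q\<close>, so the section is built directly: the
      identity minus \<open>j i \<cdot> r\<close> kills \<open>j i\<close> and hence factors through
      \<open>q\<close>.\<close>
    obtain d where d: "d \<in> Hom C (Y (Suc i)) (Y (Suc i))" "arr_add C d (j i \<cdot> r) = ident C (Y (Suc i))"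
      using difference[of "ident C (Y (Suc i))" "Y (Suc i)" "Y (Suc i)" "j i \<cdot> r"] by (auto simp: Hom_iff)
    note [simp] = HomD(1-3)[OF d(1)]
    have "arr_add C d (j i \<cdot> r) \<cdot> j i = arr_add C (d \<cdot> j i) (j i)"
      by (subst cmp_add) (auto simp: cmp_cmp rj)
    then have "arr_add C (d \<cdot> j i) (j i) = j i" by (simp add: d(2))
    then have "d \<cdot> j i = arr_zero C (Y i) (Y (Suc i))"
      by (rule add_eq_right_imp_zero) (auto simp: Hom_iff)
    then obtain s where [simp]: "s \<in> Ar C" "src C s = tgt C q" "tgt C s = Y (Suc i)" and sq: "s \<cdot> q = d"
      using is_cokernel_factor[OF q(1), of d] by auto
    have "q \<cdot> arr_add C d (j i \<cdot> r) = arr_add C (q \<cdot> d) (arr_zero C (Y (Suc i)) (tgt C q))"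
      using cmp_reassoc[OF is_cokernelD(4)[OF q(1)], of r] by (subst cmp_add) auto
    then have "q \<cdot> d = q" by (simp add: d(2))
    then have "(q \<cdot> s) \<cdot> q = ident C (tgt C q) \<cdot> q" by (simp add: cmp_cmp sq)
    then have qs: "q \<cdot> s = ident C (tgt C q)" by (rule is_epiD[OF qe]) auto
    have "r \<cdot> arr_add C d (j i \<cdot> r) = arr_add C (r \<cdot> d) r"
      using cmp_reassoc[OF rj, of r] by (subst cmp_add) auto
    then have "arr_add C (r \<cdot> d) r = r" by (simp add: d(2))
    then have "r \<cdot> d = arr_zero C (Y (Suc i)) (Y i)"
      by (rule add_eq_right_imp_zero) (auto simp: Hom_iff)
    then have "(r \<cdot> s) \<cdot> q = arr_zero C (tgt C q) (Y i) \<cdot> q" by (simp add: cmp_cmp sq)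
    then have rs: "r \<cdot> s = arr_zero C (tgt C q) (Y i)" by (rule is_epiD[OF qe]) auto
    show ?case
      by (rule semisimple_extension[where j = "j i" and r = r and s = s and q = q, OF _ q(2)])
        (use Suc rj qs rs sq d(2) in \<open>auto simp: Hom_iff\<close>)
  qed
  from this[of n] Yn show ?thesis by simp
qed

end

section \<open>Coherence of the unit constraints\<close>

text \<open>For \<open>W\<close> left dual to \<open>V\<close>, the functor W \<otimes> _ is left
  adjoint to V \<otimes> _. This is the unit of that adjunction at \<open>B\<close>, and
  \<open>counit_map\<close> is its counit.\<close>

definition unit_map :: "('o, 'a, 'k, 'm) tensor_cat_scheme \<Rightarrow> 'o \<Rightarrow> 'o \<Rightarrow> 'a \<Rightarrow> 'o \<Rightarrow> 'a" where
  "unit_map C V W coev B =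
     assoc C V W B \<cdot>\<^bsub>C\<^esub> ((coev \<otimes>\<^sub>a\<^bsub>C\<^esub> ident C B) \<cdot>\<^bsub>C\<^esub> inverse_arrow C (lunit C B))"

definition counit_map :: "('o, 'a, 'k, 'm) tensor_cat_scheme \<Rightarrow> 'o \<Rightarrow> 'o \<Rightarrow> 'a \<Rightarrow> 'o \<Rightarrow> 'a" where
  "counit_map C V W ev B =
     lunit C B \<cdot>\<^bsub>C\<^esub> ((ev \<otimes>\<^sub>a\<^bsub>C\<^esub> ident C B) \<cdot>\<^bsub>C\<^esub> inverse_arrow C (assoc C W V B))"

context monoidal_category
begin

abbreviation "I \<equiv> unit_ob C"
abbreviation "idt \<equiv> ident C"
abbreviation "\<alpha> \<equiv> assoc C"
abbreviation "\<alpha>i X Y Z \<equiv> inverse_arrow C (assoc C X Y Z)"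
abbreviation "\<l> \<equiv> lunit C"
abbreviation "\<l>i X \<equiv> inverse_arrow C (lunit C X)"
abbreviation "\<r> \<equiv> runit C"
abbreviation "\<r>i X \<equiv> inverse_arrow C (runit C X)"

section \<open>Calculus of tensor products of arrows\<close>

lemma unit_Ob [simp]: "I \<in> Ob C"
  by (rule unit_ob_closed)

lemma tensor_Ob [simp]: "X \<in> Ob C \<Longrightarrow> Y \<in> Ob C \<Longrightarrow> X \<otimes>\<^sub>o Y \<in> Ob C"
  by (rule tensor_ob_closed)

lemma tensor_simps [simp]:
  assumes "f \<in> Ar C" "g \<in> Ar C"
  shows "f \<otimes>\<^sub>a g \<in> Ar C" "src C (f \<otimes>\<^sub>a g) = src C f \<otimes>\<^sub>o src C g" "tgt C (f \<otimes>\<^sub>a g) = tgt C f \<otimes>\<^sub>o tgt C g"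
  using tensor_ar_closed[OF Hom_self Hom_self] assms by (auto simp: Hom_iff)

declare tensor_ident [simp]

lemma structure_iso [simp]:
  "X \<in> Ob C \<Longrightarrow> Y \<in> Ob C \<Longrightarrow> Z \<in> Ob C \<Longrightarrow> is_iso C (\<alpha> X Y Z)"
  "X \<in> Ob C \<Longrightarrow> is_iso C (\<l> X)" "X \<in> Ob C \<Longrightarrow> is_iso C (\<r> X)"
  using assoc_iso lunit_iso runit_iso by auto

lemma structure_simps [simp]:
  "X \<in> Ob C \<Longrightarrow> Y \<in> Ob C \<Longrightarrow> Z \<in> Ob C \<Longrightarrow> src C (\<alpha> X Y Z) = (X \<otimes>\<^sub>o Y) \<otimes>\<^sub>o Z"
  "X \<in> Ob C \<Longrightarrow> Y \<in> Ob C \<Longrightarrow> Z \<in> Ob C \<Longrightarrow> tgt C (\<alpha> X Y Z) = X \<otimes>\<^sub>o (Y \<otimes>\<^sub>o Z)"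
  "X \<in> Ob C \<Longrightarrow> src C (\<l> X) = I \<otimes>\<^sub>o X" "X \<in> Ob C \<Longrightarrow> tgt C (\<l> X) = X"
  "X \<in> Ob C \<Longrightarrow> src C (\<r> X) = X \<otimes>\<^sub>o I" "X \<in> Ob C \<Longrightarrow> tgt C (\<r> X) = X"
  using assoc_closed[of X Y Z] lunit_closed[of X] runit_closed[of X] by (auto simp: Hom_iff)

lemma is_iso_ident [simp]: "X \<in> Ob C \<Longrightarrow> is_iso C (idt X)"
  by (rule is_isoI[of _ "idt X"]) simp_all

lemma merge:
  assumes "a \<in> Ar C" "b \<in> Ar C" "c \<in> Ar C" "d \<in> Ar C" "src C a = tgt C c" "src C b = tgt C d"
  shows "(a \<otimes>\<^sub>a b) \<cdot> (c \<otimes>\<^sub>a d) = (a \<cdot> c) \<otimes>\<^sub>a (b \<cdot> d)"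
  using tensor_cmp[of c "src C c" "tgt C c" a "tgt C a" d "src C d" "tgt C d" b "tgt C b"] assms
  by (auto simp: Hom_iff)

lemma merge_cmp:
  assumes "a \<in> Ar C" "b \<in> Ar C" "c \<in> Ar C" "d \<in> Ar C" "src C a = tgt C c" "src C b = tgt C d"
    "x \<in> Ar C" "tgt C x = src C c \<otimes>\<^sub>o src C d"
  shows "(a \<otimes>\<^sub>a b) \<cdot> ((c \<otimes>\<^sub>a d) \<cdot> x) = ((a \<cdot> c) \<otimes>\<^sub>a (b \<cdot> d)) \<cdot> x"
  using assms by (intro cmp_reassoc merge) auto

text \<open>Right-nests composites and fuses adjacent tensor products. Associators block the fusion,
  which is why the calculations below alternate these rules with explicit naturality steps.\<close>

lemmas cmp_simp = cmp_cmp merge merge_cmp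

lemma assoc_nat:
  assumes "f \<in> Ar C" "g \<in> Ar C" "h \<in> Ar C"
  shows "\<alpha> (tgt C f) (tgt C g) (tgt C h) \<cdot> ((f \<otimes>\<^sub>a g) \<otimes>\<^sub>a h) =
    (f \<otimes>\<^sub>a (g \<otimes>\<^sub>a h)) \<cdot> \<alpha> (src C f) (src C g) (src C h)"
  using assoc_natural[OF Hom_self Hom_self Hom_self] assms by auto

lemma assoc_inv_nat:
  assumes "f \<in> Ar C" "g \<in> Ar C" "h \<in> Ar C"
  shows "\<alpha>i (tgt C f) (tgt C g) (tgt C h) \<cdot> (f \<otimes>\<^sub>a (g \<otimes>\<^sub>a h)) =
    ((f \<otimes>\<^sub>a g) \<otimes>\<^sub>a h) \<cdot> \<alpha>i (src C f) (src C g) (src C h)"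
proof -
  have "\<alpha> (tgt C f) (tgt C g) (tgt C h) \<cdot> (((f \<otimes>\<^sub>a g) \<otimes>\<^sub>a h) \<cdot> \<alpha>i (src C f) (src C g) (src C h)) =
    f \<otimes>\<^sub>a (g \<otimes>\<^sub>a h)"
    using assms by (subst cmp_reassoc[OF assoc_nat]) (auto simp: cmp_cmp)
  then show ?thesis using assms by (intro inverse_move) auto
qed

lemma lunit_nat: "f \<in> Ar C \<Longrightarrow> \<l> (tgt C f) \<cdot> (idt I \<otimes>\<^sub>a f) = f \<cdot> \<l> (src C f)"
  using lunit_natural[OF Hom_self] by auto

lemma runit_nat: "f \<in> Ar C \<Longrightarrow> \<r> (tgt C f) \<cdot> (f \<otimes>\<^sub>a idt I) = f \<cdot> \<r> (src C f)"
  using runit_natural[OF Hom_self] by auto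

lemma lunit_inv_nat: "f \<in> Ar C \<Longrightarrow> \<l>i (tgt C f) \<cdot> f = (idt I \<otimes>\<^sub>a f) \<cdot> \<l>i (src C f)"
proof -
  assume f: "f \<in> Ar C"
  have "\<l> (tgt C f) \<cdot> ((idt I \<otimes>\<^sub>a f) \<cdot> \<l>i (src C f)) = f"
    using f by (subst cmp_reassoc[OF lunit_nat]) (auto simp: cmp_cmp)
  then show ?thesis using f by (intro inverse_move) auto
qed

lemma pentagon':
  assumes "W \<in> Ob C" "X \<in> Ob C" "Y \<in> Ob C" "Z \<in> Ob C"
  shows "\<alpha> W X (Y \<otimes>\<^sub>o Z) \<cdot> \<alpha> (W \<otimes>\<^sub>o X) Y Z =
    (idt W \<otimes>\<^sub>a \<alpha> X Y Z) \<cdot> (\<alpha> W (X \<otimes>\<^sub>o Y) Z \<cdot> (\<alpha> W X Y \<otimes>\<^sub>a idt Z))"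
  using pentagon[OF assms] assms by (simp add: cmp_cmp)

lemma is_iso_tensor:
  assumes [simp]: "is_iso C f" "is_iso C g"
  shows "is_iso C (f \<otimes>\<^sub>a g)"
  by (rule is_isoI[of _ "inverse_arrow C f \<otimes>\<^sub>a inverse_arrow C g"]) (simp_all add: merge)

text \<open>The left unitor conjugates \<open>idt I \<otimes>\<^sub>a f\<close> to \<open>f\<close>.
  This permits proving an equation after tensoring with the unit, where pentagon and triangle
  apply.\<close>

lemma unit_tensor_faithful:
  assumes "idt I \<otimes>\<^sub>a f = idt I \<otimes>\<^sub>a g" "f \<in> Ar C" "g \<in> Ar C" "src C f = src C g" "tgt C f = tgt C g"
  shows "f = g"
proof -
  have "f \<cdot> \<l> (src C g) = g \<cdot> \<l> (src C g)"
    using lunit_nat[OF assms(2)] lunit_nat[OF assms(3)] assms(1,4,5) by metis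
  then show ?thesis by (rule is_epiD[OF is_iso_epi, rotated]) (use assms(2-5) in simp_all)
qed

lemma tensor_unit_faithful:
  assumes "f \<otimes>\<^sub>a idt I = g \<otimes>\<^sub>a idt I" "f \<in> Ar C" "g \<in> Ar C" "src C f = src C g" "tgt C f = tgt C g"
  shows "f = g"
proof -
  have "f \<cdot> \<r> (src C g) = g \<cdot> \<r> (src C g)"
    using runit_nat[OF assms(2)] runit_nat[OF assms(3)] assms(1,4,5) by metis
  then show ?thesis by (rule is_epiD[OF is_iso_epi, rotated]) (use assms(2-5) in simp_all)
qed

text \<open>Kelly's argument: the pentagon at I, I, X, Y together with the triangle gives the claim
  tensored with I and precomposed with the isomorphism \<open>?P\<close>; both decorations can be
  cancelled.\<close>

lemma lunit_tensor:
  assumes [simp]: "X \<in> Ob C" "Y \<in> Ob C"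
  shows "\<l> (X \<otimes>\<^sub>o Y) \<cdot> \<alpha> I X Y = \<l> X \<otimes>\<^sub>a idt Y"
proof (rule unit_tensor_faithful)
  let ?P = "\<alpha> I (I \<otimes>\<^sub>o X) Y \<cdot> (\<alpha> I I X \<otimes>\<^sub>a idt Y)"
  have iso: "is_iso C ?P"
    by (intro is_iso_cmp is_iso_tensor) simp_all
  have "(idt I \<otimes>\<^sub>a (\<l> (X \<otimes>\<^sub>o Y) \<cdot> \<alpha> I X Y)) \<cdot> ?P =
      (idt I \<otimes>\<^sub>a \<l> (X \<otimes>\<^sub>o Y)) \<cdot> (\<alpha> I I (X \<otimes>\<^sub>o Y) \<cdot> \<alpha> (I \<otimes>\<^sub>o I) X Y)"
    by (subst pentagon') (simp_all add: cmp_simp)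
  also have "\<dots> = (\<r> I \<otimes>\<^sub>a idt (X \<otimes>\<^sub>o Y)) \<cdot> \<alpha> (I \<otimes>\<^sub>o I) X Y"
    by (subst cmp_reassoc[OF triangle]) simp_all
  also have "\<dots> = \<alpha> I X Y \<cdot> ((\<r> I \<otimes>\<^sub>a idt X) \<otimes>\<^sub>a idt Y)"
    using assoc_nat[of "\<r> I" "idt X" "idt Y"] by simp
  also have "\<dots> = \<alpha> I X Y \<cdot> (((idt I \<otimes>\<^sub>a \<l> X) \<otimes>\<^sub>a idt Y) \<cdot> (\<alpha> I I X \<otimes>\<^sub>a idt Y))"
    by (simp add: merge triangle[symmetric])
  also have "\<dots> = (idt I \<otimes>\<^sub>a (\<l> X \<otimes>\<^sub>a idt Y)) \<cdot> ?P"
    using assoc_nat[of "idt I" "\<l> X" "idt Y"] by (subst cmp_reassoc) (auto simp: cmp_cmp)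
  finally show "idt I \<otimes>\<^sub>a (\<l> (X \<otimes>\<^sub>o Y) \<cdot> \<alpha> I X Y) = idt I \<otimes>\<^sub>a (\<l> X \<otimes>\<^sub>a idt Y)"
    by (rule is_epiD[OF is_iso_epi[OF iso]]) simp_all
qed auto

text \<open>The mirror image of the previous argument, from the pentagon at X, Y, I, I; the claim
  appears tensored with I on the right and followed by an associator.\<close>

lemma runit_tensor:
  assumes [simp]: "X \<in> Ob C" "Y \<in> Ob C"
  shows "(idt X \<otimes>\<^sub>a \<r> Y) \<cdot> \<alpha> X Y I = \<r> (X \<otimes>\<^sub>o Y)"
proof (rule tensor_unit_faithful)
  have "\<alpha> X Y I \<cdot> (((idt X \<otimes>\<^sub>a \<r> Y) \<cdot> \<alpha> X Y I) \<otimes>\<^sub>a idt I) =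
      (\<alpha> X Y I \<cdot> ((idt X \<otimes>\<^sub>a \<r> Y) \<otimes>\<^sub>a idt I)) \<cdot> (\<alpha> X Y I \<otimes>\<^sub>a idt I)"
    by (simp add: cmp_simp)
  also have "\<dots> = ((idt X \<otimes>\<^sub>a (\<r> Y \<otimes>\<^sub>a idt I)) \<cdot> \<alpha> X (Y \<otimes>\<^sub>o I) I) \<cdot> (\<alpha> X Y I \<otimes>\<^sub>a idt I)"
    using assoc_nat[of "idt X" "\<r> Y" "idt I"] by simp
  also have "\<dots> = (idt X \<otimes>\<^sub>a (idt Y \<otimes>\<^sub>a \<l> I)) \<cdot> ((idt X \<otimes>\<^sub>a \<alpha> Y I I) \<cdot> (\<alpha> X (Y \<otimes>\<^sub>o I) I \<cdot> (\<alpha> X Y I \<otimes>\<^sub>a idt I)))"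
    by (simp add: cmp_simp triangle)
  also have "\<dots> = (idt X \<otimes>\<^sub>a (idt Y \<otimes>\<^sub>a \<l> I)) \<cdot> (\<alpha> X Y (I \<otimes>\<^sub>o I) \<cdot> \<alpha> (X \<otimes>\<^sub>o Y) I I)"
    by (subst pentagon') simp_all
  also have "\<dots> = \<alpha> X Y I \<cdot> ((idt (X \<otimes>\<^sub>o Y) \<otimes>\<^sub>a \<l> I) \<cdot> \<alpha> (X \<otimes>\<^sub>o Y) I I)"
    using assoc_nat[of "idt X" "idt Y" "\<l> I"] by (simp add: cmp_cmp[symmetric])
  also have "\<dots> = \<alpha> X Y I \<cdot> (\<r> (X \<otimes>\<^sub>o Y) \<otimes>\<^sub>a idt I)"
    by (simp add: triangle)
  finally show "((idt X \<otimes>\<^sub>a \<r> Y) \<cdot> \<alpha> X Y I) \<otimes>\<^sub>a idt I = \<r> (X \<otimes>\<^sub>o Y) \<otimes>\<^sub>a idt I"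
    by (rule is_monoD[OF is_iso_mono, rotated]) simp_all
qed auto

text \<open>Naturality of the left unitor at itself identifies
  \<open>idt I \<otimes>\<^sub>a \<l> I\<close> with the unitor of I \<otimes> I. With that,
  \<open>lunit_tensor\<close> and the triangle at I, I have the same left side.\<close>

lemma lunit_unit: "\<l> I = \<r> I"
proof (rule tensor_unit_faithful)
  have "\<l> I \<cdot> (idt I \<otimes>\<^sub>a \<l> I) = \<l> I \<cdot> \<l> (I \<otimes>\<^sub>o I)"
    using lunit_nat[of "\<l> I"] by simp
  then have "idt I \<otimes>\<^sub>a \<l> I = \<l> (I \<otimes>\<^sub>o I)"
    by (rule is_monoD[OF is_iso_mono, rotated]) simp_all
  then show "\<l> I \<otimes>\<^sub>a idt I = \<r> I \<otimes>\<^sub>a idt I"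
    using lunit_tensor[of I I] triangle[of I I] by simp
qed auto


end

section \<open>Dual pairs\<close>

context monoidal_category
begin

text \<open>A left dual with its evaluation and coevaluation fixed, the zigzags being bracketed to
  the right to match the normal form of \<open>cmp_cmp\<close>.\<close>

definition dual_pair :: "'o \<Rightarrow> 'o \<Rightarrow> 'a \<Rightarrow> 'a \<Rightarrow> bool" where
  "dual_pair V W ev coev \<longleftrightarrow> V \<in> Ob C \<and> W \<in> Ob C \<and>
     ev \<in> Hom C (W \<otimes>\<^sub>o V) I \<and> coev \<in> Hom C I (V \<otimes>\<^sub>o W) \<and>
     \<r> V \<cdot> ((idt V \<otimes>\<^sub>a ev) \<cdot> (\<alpha> V W V \<cdot> ((coev \<otimes>\<^sub>a idt V) \<cdot> \<l>i V))) = idt V \<and>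
     \<l> W \<cdot> ((ev \<otimes>\<^sub>a idt W) \<cdot> (\<alpha>i W V W \<cdot> ((idt W \<otimes>\<^sub>a coev) \<cdot> \<r>i W))) = idt W"

lemma left_dual_dual_pair:
  assumes "is_left_dual C V W"
  obtains ev coev where "dual_pair V W ev coev"
proof -
  obtain ev coev where VW: "V \<in> Ob C" "W \<in> Ob C" "ev \<in> Hom C (W \<otimes>\<^sub>o V) I" "coev \<in> Hom C I (V \<otimes>\<^sub>o W)"
    and z: "\<r> V \<cdot> (idt V \<otimes>\<^sub>a ev) \<cdot> \<alpha> V W V \<cdot> (coev \<otimes>\<^sub>a idt V) \<cdot> \<l>i V = idt V"
      "\<l> W \<cdot> (ev \<otimes>\<^sub>a idt W) \<cdot> \<alpha>i W V W \<cdot> (idt W \<otimes>\<^sub>a coev) \<cdot> \<r>i W = idt W"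
    using assms unfolding is_left_dual_def by blast
  have "dual_pair V W ev coev"
    unfolding dual_pair_def using VW HomD(1-3)[OF VW(3)] HomD(1-3)[OF VW(4)] z
    by (simp add: cmp_cmp)
  then show ?thesis by (rule that)
qed

lemma dual_pairD:
  assumes "dual_pair V W ev coev"
  shows "V \<in> Ob C" "W \<in> Ob C" "ev \<in> Ar C" "src C ev = W \<otimes>\<^sub>o V" "tgt C ev = I"
    "coev \<in> Ar C" "src C coev = I" "tgt C coev = V \<otimes>\<^sub>o W"
  using assms by (auto simp: dual_pair_def Hom_iff)

lemma dual_pair_zigzag:
  assumes "dual_pair V W ev coev"
  shows "\<r> V \<cdot> ((idt V \<otimes>\<^sub>a ev) \<cdot> (\<alpha> V W V \<cdot> ((coev \<otimes>\<^sub>a idt V) \<cdot> \<l>i V))) = idt V"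
    "\<l> W \<cdot> ((ev \<otimes>\<^sub>a idt W) \<cdot> (\<alpha>i W V W \<cdot> ((idt W \<otimes>\<^sub>a coev) \<cdot> \<r>i W))) = idt W"
  using assms by (simp_all add: dual_pair_def)

lemma lunit_inv_tensor:
  assumes [simp]: "X \<in> Ob C" "Y \<in> Ob C"
  shows "\<l>i (X \<otimes>\<^sub>o Y) = \<alpha> I X Y \<cdot> (\<l>i X \<otimes>\<^sub>a idt Y)"
proof -
  have "\<l> (X \<otimes>\<^sub>o Y) \<cdot> (\<alpha> I X Y \<cdot> (\<l>i X \<otimes>\<^sub>a idt Y)) = idt (X \<otimes>\<^sub>o Y)"
    by (subst cmp_reassoc[OF lunit_tensor]) (simp_all add: merge)
  from inverse_move[OF _ _ _ _ this] show ?thesis by simp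
qed

lemma triangle_inv:
  assumes [simp]: "X \<in> Ob C" "Y \<in> Ob C"
  shows "\<alpha> X I Y \<cdot> (\<r>i X \<otimes>\<^sub>a idt Y) = idt X \<otimes>\<^sub>a \<l>i Y"
proof -
  have "(idt X \<otimes>\<^sub>a \<l> Y) \<cdot> (\<alpha> X I Y \<cdot> (\<r>i X \<otimes>\<^sub>a idt Y)) = (idt X \<otimes>\<^sub>a \<l> Y) \<cdot> (idt X \<otimes>\<^sub>a \<l>i Y)"
    by (subst cmp_reassoc[OF triangle]) (simp_all add: merge)
  then show ?thesis by (rule is_monoD[OF is_iso_mono, rotated]) (simp_all add: is_iso_tensor)
qed

section \<open>The adjunction given by a dual pair\<close>

lemma unit_map_simps [simp]:
  assumes "dual_pair V W ev coev" "B \<in> Ob C"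
  shows "unit_map C V W coev B \<in> Ar C" "src C (unit_map C V W coev B) = B"
    "tgt C (unit_map C V W coev B) = V \<otimes>\<^sub>o (W \<otimes>\<^sub>o B)"
  using dual_pairD[OF assms(1)] assms(2) by (simp_all add: unit_map_def)

lemma counit_map_simps [simp]:
  assumes "dual_pair V W ev coev" "B \<in> Ob C"
  shows "counit_map C V W ev B \<in> Ar C" "src C (counit_map C V W ev B) = W \<otimes>\<^sub>o (V \<otimes>\<^sub>o B)"
    "tgt C (counit_map C V W ev B) = B"
  using dual_pairD[OF assms(1)] assms(2) by (simp_all add: counit_map_def)

lemma unit_map_nat:
  assumes "dual_pair V W ev coev" and g: "g \<in> Ar C"
  shows "unit_map C V W coev (tgt C g) \<cdot> g = (idt V \<otimes>\<^sub>a (idt W \<otimes>\<^sub>a g)) \<cdot> unit_map C V W coev (src C g)"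
proof -
  note [simp] = dual_pairD[OF assms(1)] g
  have "unit_map C V W coev (tgt C g) \<cdot> g =
      \<alpha> V W (tgt C g) \<cdot> ((coev \<otimes>\<^sub>a idt (tgt C g)) \<cdot> (\<l>i (tgt C g) \<cdot> g))"
    by (simp add: unit_map_def cmp_cmp)
  also have "\<dots> = \<alpha> V W (tgt C g) \<cdot> (((idt V \<otimes>\<^sub>a idt W) \<otimes>\<^sub>a g) \<cdot> ((coev \<otimes>\<^sub>a idt (src C g)) \<cdot> \<l>i (src C g)))"
    by (simp add: lunit_inv_nat merge_cmp)
  also have "\<dots> = (idt V \<otimes>\<^sub>a (idt W \<otimes>\<^sub>a g)) \<cdot> unit_map C V W coev (src C g)"
    using assoc_nat[of "idt V" "idt W" g]
    by (subst cmp_reassoc[of _ _ "(idt V \<otimes>\<^sub>a (idt W \<otimes>\<^sub>a g)) \<cdot> \<alpha> V W (src C g)"])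
      (simp_all add: unit_map_def cmp_cmp)
  finally show ?thesis .
qed

lemma counit_map_nat:
  assumes "dual_pair V W ev coev" and g: "g \<in> Ar C"
  shows "counit_map C V W ev (tgt C g) \<cdot> (idt W \<otimes>\<^sub>a (idt V \<otimes>\<^sub>a g)) = g \<cdot> counit_map C V W ev (src C g)"
proof -
  note [simp] = dual_pairD[OF assms(1)] g
  have "counit_map C V W ev (tgt C g) \<cdot> (idt W \<otimes>\<^sub>a (idt V \<otimes>\<^sub>a g)) =
      \<l> (tgt C g) \<cdot> ((ev \<otimes>\<^sub>a idt (tgt C g)) \<cdot> (\<alpha>i W V (tgt C g) \<cdot> (idt W \<otimes>\<^sub>a (idt V \<otimes>\<^sub>a g))))"
    by (simp add: counit_map_def cmp_cmp)
  also have "\<alpha>i W V (tgt C g) \<cdot> (idt W \<otimes>\<^sub>a (idt V \<otimes>\<^sub>a g)) = ((idt W \<otimes>\<^sub>a idt V) \<otimes>\<^sub>a g) \<cdot> \<alpha>i W V (src C g)"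
    using assoc_inv_nat[of "idt W" "idt V" g] by simp
  also have "\<l> (tgt C g) \<cdot> ((ev \<otimes>\<^sub>a idt (tgt C g)) \<cdot> (((idt W \<otimes>\<^sub>a idt V) \<otimes>\<^sub>a g) \<cdot> \<alpha>i W V (src C g))) =
      (\<l> (tgt C g) \<cdot> (idt I \<otimes>\<^sub>a g)) \<cdot> ((ev \<otimes>\<^sub>a idt (src C g)) \<cdot> \<alpha>i W V (src C g))"
    by (simp add: cmp_simp)
  also have "\<dots> = g \<cdot> counit_map C V W ev (src C g)"
    by (subst lunit_nat) (simp_all add: counit_map_def cmp_cmp)
  finally show ?thesis .
qed

text \<open>Unit coherence and the pentagon turn the unit at V \<otimes> B into the first half of
  the zigzag of V tensored with \<open>B\<close>. Naturality and the triangle do the same for the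
  counit, so the composite is the whole zigzag tensored with \<open>B\<close>.\<close>

lemma unit_counit:
  assumes "dual_pair V W ev coev" and B: "B \<in> Ob C"
  shows "(idt V \<otimes>\<^sub>a counit_map C V W ev B) \<cdot> unit_map C V W coev (V \<otimes>\<^sub>o B) = idt (V \<otimes>\<^sub>o B)"
proof -
  note [simp] = dual_pairD[OF assms(1)] B
  define z where "z = \<alpha> V W V \<cdot> ((coev \<otimes>\<^sub>a idt V) \<cdot> \<l>i V)"
  have [simp]: "z \<in> Ar C" "src C z = V" "tgt C z = V \<otimes>\<^sub>o (W \<otimes>\<^sub>o V)" by (simp_all add: z_def)
  have "unit_map C V W coev (V \<otimes>\<^sub>o B) =
      \<alpha> V W (V \<otimes>\<^sub>o B) \<cdot> (((coev \<otimes>\<^sub>a idt (V \<otimes>\<^sub>o B)) \<cdot> \<alpha> I V B) \<cdot> (\<l>i V \<otimes>\<^sub>a idt B))"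
    by (simp add: unit_map_def lunit_inv_tensor cmp_cmp)
  also have "(coev \<otimes>\<^sub>a idt (V \<otimes>\<^sub>o B)) \<cdot> \<alpha> I V B = \<alpha> (V \<otimes>\<^sub>o W) V B \<cdot> ((coev \<otimes>\<^sub>a idt V) \<otimes>\<^sub>a idt B)"
    using assoc_nat[of coev "idt V" "idt B"] by simp
  also have "\<alpha> V W (V \<otimes>\<^sub>o B) \<cdot> ((\<alpha> (V \<otimes>\<^sub>o W) V B \<cdot> ((coev \<otimes>\<^sub>a idt V) \<otimes>\<^sub>a idt B)) \<cdot> (\<l>i V \<otimes>\<^sub>a idt B)) =
      (\<alpha> V W (V \<otimes>\<^sub>o B) \<cdot> \<alpha> (V \<otimes>\<^sub>o W) V B) \<cdot> (((coev \<otimes>\<^sub>a idt V) \<cdot> \<l>i V) \<otimes>\<^sub>a idt B)"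
    by (simp add: cmp_simp)
  also have "\<dots> = (idt V \<otimes>\<^sub>a \<alpha> W V B) \<cdot> (\<alpha> V (W \<otimes>\<^sub>o V) B \<cdot> (z \<otimes>\<^sub>a idt B))"
    by (subst pentagon') (simp_all add: cmp_simp z_def)
  finally have u: "unit_map C V W coev (V \<otimes>\<^sub>o B) =
      (idt V \<otimes>\<^sub>a \<alpha> W V B) \<cdot> (\<alpha> V (W \<otimes>\<^sub>o V) B \<cdot> (z \<otimes>\<^sub>a idt B))" .
  have "(idt V \<otimes>\<^sub>a counit_map C V W ev B) \<cdot> unit_map C V W coev (V \<otimes>\<^sub>o B) =
      (idt V \<otimes>\<^sub>a \<l> B) \<cdot> (((idt V \<otimes>\<^sub>a (ev \<otimes>\<^sub>a idt B)) \<cdot> \<alpha> V (W \<otimes>\<^sub>o V) B) \<cdot> (z \<otimes>\<^sub>a idt B))"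
    unfolding u by (simp add: counit_map_def cmp_simp)
  also have "(idt V \<otimes>\<^sub>a (ev \<otimes>\<^sub>a idt B)) \<cdot> \<alpha> V (W \<otimes>\<^sub>o V) B = \<alpha> V I B \<cdot> ((idt V \<otimes>\<^sub>a ev) \<otimes>\<^sub>a idt B)"
    using assoc_nat[of "idt V" ev "idt B"] by simp
  also have "(idt V \<otimes>\<^sub>a \<l> B) \<cdot> ((\<alpha> V I B \<cdot> ((idt V \<otimes>\<^sub>a ev) \<otimes>\<^sub>a idt B)) \<cdot> (z \<otimes>\<^sub>a idt B)) =
      ((idt V \<otimes>\<^sub>a \<l> B) \<cdot> \<alpha> V I B) \<cdot> (((idt V \<otimes>\<^sub>a ev) \<cdot> z) \<otimes>\<^sub>a idt B)"
    by (simp add: cmp_simp)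
  also have "\<dots> = (\<r> V \<cdot> ((idt V \<otimes>\<^sub>a ev) \<cdot> z)) \<otimes>\<^sub>a idt B"
    by (subst triangle) (simp_all add: merge)
  also have "\<dots> = idt (V \<otimes>\<^sub>o B)"
    using dual_pair_zigzag(1)[OF assms(1)] by (simp add: z_def)
  finally show ?thesis .
qed

text \<open>The other triangle identity, reduced in the same way to the zigzag of \<open>W\<close>
  tensored with \<open>B\<close>.\<close>

lemma counit_unit:
  assumes "dual_pair V W ev coev" and B: "B \<in> Ob C"
  shows "counit_map C V W ev (W \<otimes>\<^sub>o B) \<cdot> (idt W \<otimes>\<^sub>a unit_map C V W coev B) = idt (W \<otimes>\<^sub>o B)"
proof -
  note [simp] = dual_pairD[OF assms(1)] B
  define z where "z = (idt W \<otimes>\<^sub>a coev) \<cdot> \<r>i W"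
  have [simp]: "z \<in> Ar C" "src C z = W" "tgt C z = W \<otimes>\<^sub>o (V \<otimes>\<^sub>o W)" by (simp_all add: z_def)
  have "idt W \<otimes>\<^sub>a unit_map C V W coev B =
      (idt W \<otimes>\<^sub>a \<alpha> V W B) \<cdot> ((idt W \<otimes>\<^sub>a (coev \<otimes>\<^sub>a idt B)) \<cdot> (\<alpha> W I B \<cdot> (\<r>i W \<otimes>\<^sub>a idt B)))"
    by (simp add: unit_map_def triangle_inv merge)
  also have "\<dots> = (idt W \<otimes>\<^sub>a \<alpha> V W B) \<cdot> (((idt W \<otimes>\<^sub>a (coev \<otimes>\<^sub>a idt B)) \<cdot> \<alpha> W I B) \<cdot> (\<r>i W \<otimes>\<^sub>a idt B))"
    by (simp add: cmp_cmp)
  also have "(idt W \<otimes>\<^sub>a (coev \<otimes>\<^sub>a idt B)) \<cdot> \<alpha> W I B = \<alpha> W (V \<otimes>\<^sub>o W) B \<cdot> ((idt W \<otimes>\<^sub>a coev) \<otimes>\<^sub>a idt B)"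
    using assoc_nat[of "idt W" coev "idt B"] by simp
  also have "(idt W \<otimes>\<^sub>a \<alpha> V W B) \<cdot> ((\<alpha> W (V \<otimes>\<^sub>o W) B \<cdot> ((idt W \<otimes>\<^sub>a coev) \<otimes>\<^sub>a idt B)) \<cdot> (\<r>i W \<otimes>\<^sub>a idt B)) =
      ((idt W \<otimes>\<^sub>a \<alpha> V W B) \<cdot> (\<alpha> W (V \<otimes>\<^sub>o W) B \<cdot> (\<alpha> W V W \<otimes>\<^sub>a idt B))) \<cdot> ((\<alpha>i W V W \<cdot> z) \<otimes>\<^sub>a idt B)"
    by (simp add: cmp_simp z_def)
  also have "\<dots> = \<alpha> W V (W \<otimes>\<^sub>o B) \<cdot> (\<alpha> (W \<otimes>\<^sub>o V) W B \<cdot> ((\<alpha>i W V W \<cdot> z) \<otimes>\<^sub>a idt B))"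
    by (subst pentagon'[symmetric]) (simp_all add: cmp_cmp)
  finally have u: "idt W \<otimes>\<^sub>a unit_map C V W coev B =
      \<alpha> W V (W \<otimes>\<^sub>o B) \<cdot> (\<alpha> (W \<otimes>\<^sub>o V) W B \<cdot> ((\<alpha>i W V W \<cdot> z) \<otimes>\<^sub>a idt B))" .
  have "counit_map C V W ev (W \<otimes>\<^sub>o B) \<cdot> (idt W \<otimes>\<^sub>a unit_map C V W coev B) =
      \<l> (W \<otimes>\<^sub>o B) \<cdot> (((ev \<otimes>\<^sub>a idt (W \<otimes>\<^sub>o B)) \<cdot> \<alpha> (W \<otimes>\<^sub>o V) W B) \<cdot> ((\<alpha>i W V W \<cdot> z) \<otimes>\<^sub>a idt B))"
    unfolding u by (simp add: counit_map_def cmp_cmp)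
  also have "(ev \<otimes>\<^sub>a idt (W \<otimes>\<^sub>o B)) \<cdot> \<alpha> (W \<otimes>\<^sub>o V) W B = \<alpha> I W B \<cdot> ((ev \<otimes>\<^sub>a idt W) \<otimes>\<^sub>a idt B)"
    using assoc_nat[of ev "idt W" "idt B"] by simp
  also have "\<l> (W \<otimes>\<^sub>o B) \<cdot> ((\<alpha> I W B \<cdot> ((ev \<otimes>\<^sub>a idt W) \<otimes>\<^sub>a idt B)) \<cdot> ((\<alpha>i W V W \<cdot> z) \<otimes>\<^sub>a idt B)) =
      (\<l> (W \<otimes>\<^sub>o B) \<cdot> \<alpha> I W B) \<cdot> (((ev \<otimes>\<^sub>a idt W) \<cdot> (\<alpha>i W V W \<cdot> z)) \<otimes>\<^sub>a idt B)"
    by (simp add: cmp_simp)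
  also have "\<dots> = (\<l> W \<cdot> ((ev \<otimes>\<^sub>a idt W) \<cdot> (\<alpha>i W V W \<cdot> z))) \<otimes>\<^sub>a idt B"
    by (subst lunit_tensor) (simp_all add: merge)
  also have "\<dots> = idt (W \<otimes>\<^sub>o B)"
    using dual_pair_zigzag(2)[OF assms(1)] by (simp add: z_def)
  finally show ?thesis .
qed

text \<open>The arrow \<open>g\<close> inserts the coevaluation behind \<open>T\<close> and applies
  \<open>k\<close> to the first two factors; a zigzag of \<open>W\<close> then gives back
  \<open>k\<close>. With \<open>T\<close> a dual of V this produces the transpose of an arrow from W
  to V.\<close>

lemma evaluation_universal:
  assumes "dual_pair W W' ev coev" "k \<in> Hom C (T \<otimes>\<^sub>o W) I" and T: "T \<in> Ob C"
  obtains g where "g \<in> Hom C T W'" "ev \<cdot> (g \<otimes>\<^sub>a idt W) = k"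
proof -
  note [simp] = dual_pairD[OF assms(1)] HomD(1-3)[OF assms(2)] T
  define v where "v = (idt T \<otimes>\<^sub>a coev) \<cdot> \<r>i T"
  define u where "u = \<alpha>i T W W' \<cdot> v"
  define g where "g = \<l> W' \<cdot> ((k \<otimes>\<^sub>a idt W') \<cdot> u)"
  have [simp]: "v \<in> Ar C" "src C v = T" "tgt C v = T \<otimes>\<^sub>o (W \<otimes>\<^sub>o W')"
    by (simp_all add: v_def)
  have [simp]: "u \<in> Ar C" "src C u = T" "tgt C u = (T \<otimes>\<^sub>o W) \<otimes>\<^sub>o W'"
    by (simp_all add: u_def)
  have g: "g \<in> Hom C T W'" by (simp add: g_def Hom_iff)
  define z where "z = (idt W \<otimes>\<^sub>a ev) \<cdot> (\<alpha> W W' W \<cdot> ((coev \<otimes>\<^sub>a idt W) \<cdot> \<l>i W))"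
  have [simp]: "z \<in> Ar C" "src C z = W" "tgt C z = W \<otimes>\<^sub>o I" by (simp_all add: z_def)
  have "\<r> W \<cdot> z = idt W" using dual_pair_zigzag(1)[OF assms(1)] by (simp add: z_def)
  from inverse_move[OF _ _ _ _ this] have z: "z = \<r>i W" by simp

  \<comment> \<open>The part of \<open>ev \<cdot> (g \<otimes>\<^sub>a idt W)\<close> that does not
    involve \<open>k\<close>: create W \<otimes> W', then evaluate W' against the old W. The zigzag
    shows that \<open>l\<close> is just the inverse right unitor.\<close>
  define l where "l = (idt (T \<otimes>\<^sub>o W) \<otimes>\<^sub>a ev) \<cdot> (\<alpha> (T \<otimes>\<^sub>o W) W' W \<cdot> (u \<otimes>\<^sub>a idt W))"
  have [simp]: "l \<in> Ar C" "src C l = T \<otimes>\<^sub>o W" "tgt C l = (T \<otimes>\<^sub>o W) \<otimes>\<^sub>o I" by (simp_all add: l_def)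
  have "\<alpha> T W I \<cdot> l = (\<alpha> T W I \<cdot> ((idt T \<otimes>\<^sub>a idt W) \<otimes>\<^sub>a ev)) \<cdot> (\<alpha> (T \<otimes>\<^sub>o W) W' W \<cdot> (u \<otimes>\<^sub>a idt W))"
    by (simp add: l_def cmp_cmp)
  also have "\<alpha> T W I \<cdot> ((idt T \<otimes>\<^sub>a idt W) \<otimes>\<^sub>a ev) = (idt T \<otimes>\<^sub>a (idt W \<otimes>\<^sub>a ev)) \<cdot> \<alpha> T W (W' \<otimes>\<^sub>o W)"
    using assoc_nat[of "idt T" "idt W" ev] by simp
  also have "((idt T \<otimes>\<^sub>a (idt W \<otimes>\<^sub>a ev)) \<cdot> \<alpha> T W (W' \<otimes>\<^sub>o W)) \<cdot> (\<alpha> (T \<otimes>\<^sub>o W) W' W \<cdot> (u \<otimes>\<^sub>a idt W)) =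
      (idt T \<otimes>\<^sub>a (idt W \<otimes>\<^sub>a ev)) \<cdot> ((\<alpha> T W (W' \<otimes>\<^sub>o W) \<cdot> \<alpha> (T \<otimes>\<^sub>o W) W' W) \<cdot> (u \<otimes>\<^sub>a idt W))"
    by (simp add: cmp_cmp)
  also have "\<alpha> T W (W' \<otimes>\<^sub>o W) \<cdot> \<alpha> (T \<otimes>\<^sub>o W) W' W =
      (idt T \<otimes>\<^sub>a \<alpha> W W' W) \<cdot> (\<alpha> T (W \<otimes>\<^sub>o W') W \<cdot> (\<alpha> T W W' \<otimes>\<^sub>a idt W))"
    by (rule pentagon') simp_all
  also have "\<dots> \<cdot> (u \<otimes>\<^sub>a idt W) = (idt T \<otimes>\<^sub>a \<alpha> W W' W) \<cdot>
      ((\<alpha> T (W \<otimes>\<^sub>o W') W \<cdot> ((idt T \<otimes>\<^sub>a coev) \<otimes>\<^sub>a idt W)) \<cdot> (\<r>i T \<otimes>\<^sub>a idt W))"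
    by (simp add: cmp_simp u_def v_def)
  also have "\<alpha> T (W \<otimes>\<^sub>o W') W \<cdot> ((idt T \<otimes>\<^sub>a coev) \<otimes>\<^sub>a idt W) = (idt T \<otimes>\<^sub>a (coev \<otimes>\<^sub>a idt W)) \<cdot> \<alpha> T I W"
    using assoc_nat[of "idt T" coev "idt W"] by simp
  also have "((idt T \<otimes>\<^sub>a (coev \<otimes>\<^sub>a idt W)) \<cdot> \<alpha> T I W) \<cdot> (\<r>i T \<otimes>\<^sub>a idt W) =
      (idt T \<otimes>\<^sub>a (coev \<otimes>\<^sub>a idt W)) \<cdot> (idt T \<otimes>\<^sub>a \<l>i W)"
    by (simp add: cmp_cmp triangle_inv)
  also have "(idt T \<otimes>\<^sub>a (idt W \<otimes>\<^sub>a ev)) \<cdot> ((idt T \<otimes>\<^sub>a \<alpha> W W' W) \<cdot>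
      ((idt T \<otimes>\<^sub>a (coev \<otimes>\<^sub>a idt W)) \<cdot> (idt T \<otimes>\<^sub>a \<l>i W))) = idt T \<otimes>\<^sub>a z"
    by (simp add: z_def merge)
  finally have "\<alpha> T W I \<cdot> l = idt T \<otimes>\<^sub>a \<r>i W" by (simp add: z)
  then have "(idt T \<otimes>\<^sub>a \<r> W) \<cdot> (\<alpha> T W I \<cdot> l) = idt (T \<otimes>\<^sub>o W)" by (simp add: merge)
  then have "\<r> (T \<otimes>\<^sub>o W) \<cdot> l = idt (T \<otimes>\<^sub>o W)" by (simp add: runit_tensor[symmetric] cmp_cmp)
  from inverse_move[OF _ _ _ _ this] have l: "l = \<r>i (T \<otimes>\<^sub>o W)" by simp

  \<comment> \<open>By interchange \<open>ev\<close> moves in front of \<open>k\<close>, which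
    isolates \<open>l\<close>. The remaining unitors cancel because the left and right unitors agree
    at I.\<close>
  have "ev \<cdot> (g \<otimes>\<^sub>a idt W) = (ev \<cdot> (\<l> W' \<otimes>\<^sub>a idt W)) \<cdot> (((k \<otimes>\<^sub>a idt W') \<otimes>\<^sub>a idt W) \<cdot> (u \<otimes>\<^sub>a idt W))"
    by (simp add: g_def cmp_simp)
  also have "ev \<cdot> (\<l> W' \<otimes>\<^sub>a idt W) = (ev \<cdot> \<l> (W' \<otimes>\<^sub>o W)) \<cdot> \<alpha> I W' W"
    by (simp add: lunit_tensor[symmetric] cmp_cmp)
  also have "ev \<cdot> \<l> (W' \<otimes>\<^sub>o W) = \<l> I \<cdot> (idt I \<otimes>\<^sub>a ev)"
    using lunit_nat[of ev] by simp
  also have "((\<l> I \<cdot> (idt I \<otimes>\<^sub>a ev)) \<cdot> \<alpha> I W' W) \<cdot> (((k \<otimes>\<^sub>a idt W') \<otimes>\<^sub>a idt W) \<cdot> (u \<otimes>\<^sub>a idt W)) =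
      \<l> I \<cdot> ((idt I \<otimes>\<^sub>a ev) \<cdot> ((\<alpha> I W' W \<cdot> ((k \<otimes>\<^sub>a idt W') \<otimes>\<^sub>a idt W)) \<cdot> (u \<otimes>\<^sub>a idt W)))"
    by (simp add: cmp_cmp)
  also have "\<alpha> I W' W \<cdot> ((k \<otimes>\<^sub>a idt W') \<otimes>\<^sub>a idt W) = (k \<otimes>\<^sub>a idt (W' \<otimes>\<^sub>o W)) \<cdot> \<alpha> (T \<otimes>\<^sub>o W) W' W"
    using assoc_nat[of k "idt W'" "idt W"] by simp
  also have "\<l> I \<cdot> ((idt I \<otimes>\<^sub>a ev) \<cdot> (((k \<otimes>\<^sub>a idt (W' \<otimes>\<^sub>o W)) \<cdot> \<alpha> (T \<otimes>\<^sub>o W) W' W) \<cdot> (u \<otimes>\<^sub>a idt W))) =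
      \<l> I \<cdot> ((k \<otimes>\<^sub>a idt I) \<cdot> l)"
    by (simp add: l_def cmp_simp)
  also have "\<dots> = (\<r> I \<cdot> (k \<otimes>\<^sub>a idt I)) \<cdot> \<r>i (T \<otimes>\<^sub>o W)"
    by (simp add: l lunit_unit cmp_cmp)
  also have "\<r> I \<cdot> (k \<otimes>\<^sub>a idt I) = k \<cdot> \<r> (T \<otimes>\<^sub>o W)"
    using runit_nat[of k] by simp
  also have "\<dots> \<cdot> \<r>i (T \<otimes>\<^sub>o W) = k" by (simp add: cmp_cmp)
  finally show ?thesis using that g by blast
qed

section \<open>Cancelling tensor factors in front of a split mono\<close>

lemma split_mono_tensor:
  assumes "split_mono C g" "A \<in> Ob C"
  shows "split_mono C (idt A \<otimes>\<^sub>a g)"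
proof -
  obtain r where "g \<in> Ar C" "r \<in> Ar C" "src C r = tgt C g" "tgt C r = src C g" "r \<cdot> g = idt (src C g)"
    using assms(1) by (rule split_monoE)
  then show ?thesis using assms(2)
    by (intro split_monoI[of "idt A \<otimes>\<^sub>a r"]) (simp_all add: merge)
qed

lemma split_mono_tensor_tensor:
  assumes "g \<in> Ar C" "A \<in> Ob C" "B \<in> Ob C"
  shows "split_mono C (idt (A \<otimes>\<^sub>o B) \<otimes>\<^sub>a g) \<longleftrightarrow> split_mono C (idt A \<otimes>\<^sub>a (idt B \<otimes>\<^sub>a g))"
proof
  note [simp] = assms
  have nat: "\<alpha> A B (tgt C g) \<cdot> (idt (A \<otimes>\<^sub>o B) \<otimes>\<^sub>a g) = (idt A \<otimes>\<^sub>a (idt B \<otimes>\<^sub>a g)) \<cdot> \<alpha> A B (src C g)"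
    using assoc_nat[of "idt A" "idt B" g] by simp
  show "split_mono C (idt A \<otimes>\<^sub>a (idt B \<otimes>\<^sub>a g))" if "split_mono C (idt (A \<otimes>\<^sub>o B) \<otimes>\<^sub>a g)"
    by (rule split_mono_conj[OF that nat]) simp_all
  have nat': "\<alpha>i A B (tgt C g) \<cdot> (idt A \<otimes>\<^sub>a (idt B \<otimes>\<^sub>a g)) = (idt (A \<otimes>\<^sub>o B) \<otimes>\<^sub>a g) \<cdot> \<alpha>i A B (src C g)"
    using assoc_inv_nat[of "idt A" "idt B" g] by simp
  show "split_mono C (idt (A \<otimes>\<^sub>o B) \<otimes>\<^sub>a g)" if "split_mono C (idt A \<otimes>\<^sub>a (idt B \<otimes>\<^sub>a g))"
    by (rule split_mono_conj[OF that nat']) (simp_all add: is_iso_inverse)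
qed

lemma split_mono_tensor_iso:
  assumes "split_mono C (idt (src C a) \<otimes>\<^sub>a g)" "is_iso C a" "g \<in> Ar C"
  shows "split_mono C (idt (tgt C a) \<otimes>\<^sub>a g)"
proof (rule split_mono_conj[OF assms(1)])
  show "(a \<otimes>\<^sub>a idt (tgt C g)) \<cdot> (idt (src C a) \<otimes>\<^sub>a g) = (idt (tgt C a) \<otimes>\<^sub>a g) \<cdot> (a \<otimes>\<^sub>a idt (src C g))"
    using assms(2,3) by (simp add: merge)
qed (use assms(2,3) in \<open>simp_all add: is_iso_tensor\<close>)

text \<open>In the naturality square of the unit one side ends with \<open>g\<close>, and the other
  is a composite of split monos, since \<open>unit_counit\<close> retracts the unit at V \<otimes>
  B. The shape of the source of \<open>g\<close> is essential for this.\<close>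

lemma split_mono_cancel_pair:
  assumes "dual_pair V W ev coev" "B \<in> Ob C" "g \<in> Ar C" "src C g = V \<otimes>\<^sub>o B"
    and "split_mono C (idt V \<otimes>\<^sub>a (idt W \<otimes>\<^sub>a g))"
  shows "split_mono C g"
proof (rule split_mono_right_factor)
  note [simp] = dual_pairD[OF assms(1)] assms(2-4) unit_map_simps[OF assms(1)] counit_map_simps[OF assms(1)]
  have "split_mono C (unit_map C V W coev (V \<otimes>\<^sub>o B))"
    using unit_counit[OF assms(1,2)]
    by (intro split_monoI[of "idt V \<otimes>\<^sub>a counit_map C V W ev B"]) simp_all
  then have "split_mono C ((idt V \<otimes>\<^sub>a (idt W \<otimes>\<^sub>a g)) \<cdot> unit_map C V W coev (V \<otimes>\<^sub>o B))"
    by (rule split_mono_cmp[OF _ assms(5)]) simp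
  then show "split_mono C (unit_map C V W coev (tgt C g) \<cdot> g)"
    using unit_map_nat[OF assms(1,3)] by simp
qed (use assms(3) unit_map_simps[OF assms(1)] in simp_all)

lemma split_mono_cancel_dual:
  assumes "dual_pair V W ev coev" "B \<in> Ob C" "g \<in> Ar C" "src C g = V \<otimes>\<^sub>o B"
    and "split_mono C (idt W \<otimes>\<^sub>a g)"
  shows "split_mono C g"
  using split_mono_cancel_pair[OF assms(1-4)] split_mono_tensor[OF assms(5)] dual_pairD(1)[OF assms(1)]
  by blast

text \<open>Tensoring the hypothesis with \<open>W\<close> puts W \<otimes> V in front of
  \<open>g\<close>, the wrong order for the unit of the pair. The isomorphism \<open>s\<close>
  corrects the order; a swap will provide it.\<close>

lemma split_mono_cancel_self:
  assumes "dual_pair V W ev coev" "B \<in> Ob C" "g \<in> Ar C" "src C g = V \<otimes>\<^sub>o B"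
    and "split_mono C (idt V \<otimes>\<^sub>a g)" "s \<in> Hom C (W \<otimes>\<^sub>o V) (V \<otimes>\<^sub>o W)" "is_iso C s"
  shows "split_mono C g"
proof (rule split_mono_cancel_pair[OF assms(1-4)])
  note [simp] = dual_pairD[OF assms(1)] assms(3) HomD(1-3)[OF assms(6)]
  have "split_mono C (idt W \<otimes>\<^sub>a (idt V \<otimes>\<^sub>a g))" by (rule split_mono_tensor[OF assms(5)]) simp
  then have "split_mono C (idt (src C s) \<otimes>\<^sub>a g)" by (simp add: split_mono_tensor_tensor)
  from split_mono_tensor_iso[OF this assms(7,3)] show "split_mono C (idt V \<otimes>\<^sub>a (idt W \<otimes>\<^sub>a g))"
    by (simp add: split_mono_tensor_tensor)
qed

section \<open>Adjuncts, and tensoring with dualizable objects\<close>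

lemma transpose_left:
  assumes "dual_pair V W ev coev" "B \<in> Ob C" "a \<in> Ar C" "src C a = W \<otimes>\<^sub>o B"
  shows "counit_map C V W ev (tgt C a) \<cdot> (idt W \<otimes>\<^sub>a ((idt V \<otimes>\<^sub>a a) \<cdot> unit_map C V W coev B)) = a"
proof -
  note [simp] = dual_pairD[OF assms(1)] assms(2-4) unit_map_simps[OF assms(1)] counit_map_simps[OF assms(1)]
  have "idt W \<otimes>\<^sub>a ((idt V \<otimes>\<^sub>a a) \<cdot> unit_map C V W coev B) =
      (idt W \<otimes>\<^sub>a (idt V \<otimes>\<^sub>a a)) \<cdot> (idt W \<otimes>\<^sub>a unit_map C V W coev B)"
    by (simp add: merge)
  then have "counit_map C V W ev (tgt C a) \<cdot> (idt W \<otimes>\<^sub>a ((idt V \<otimes>\<^sub>a a) \<cdot> unit_map C V W coev B)) =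
      (counit_map C V W ev (tgt C a) \<cdot> (idt W \<otimes>\<^sub>a (idt V \<otimes>\<^sub>a a))) \<cdot> (idt W \<otimes>\<^sub>a unit_map C V W coev B)"
    by (simp add: cmp_cmp)
  also have "\<dots> = a \<cdot> (counit_map C V W ev (W \<otimes>\<^sub>o B) \<cdot> (idt W \<otimes>\<^sub>a unit_map C V W coev B))"
    by (subst counit_map_nat[OF assms(1)]) (simp_all add: cmp_cmp)
  also have "\<dots> = a" by (simp add: counit_unit[OF assms(1)])
  finally show ?thesis .
qed

text \<open>With \<open>transpose_left\<close>, the bijection between arrows from W \<otimes> A to B
  and arrows from A to V \<otimes> B. In particular arrows with equal adjuncts are equal.\<close>

lemma transpose_right:
  assumes "dual_pair V W ev coev" "B \<in> Ob C" "a \<in> Ar C" "tgt C a = V \<otimes>\<^sub>o B"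
  shows "(idt V \<otimes>\<^sub>a (counit_map C V W ev B \<cdot> (idt W \<otimes>\<^sub>a a))) \<cdot> unit_map C V W coev (src C a) = a"
proof -
  note [simp] = dual_pairD[OF assms(1)] assms(2-4) unit_map_simps[OF assms(1)] counit_map_simps[OF assms(1)]
  have "idt V \<otimes>\<^sub>a (counit_map C V W ev B \<cdot> (idt W \<otimes>\<^sub>a a)) =
      (idt V \<otimes>\<^sub>a counit_map C V W ev B) \<cdot> (idt V \<otimes>\<^sub>a (idt W \<otimes>\<^sub>a a))"
    by (simp add: merge)
  then have "(idt V \<otimes>\<^sub>a (counit_map C V W ev B \<cdot> (idt W \<otimes>\<^sub>a a))) \<cdot> unit_map C V W coev (src C a) =
      (idt V \<otimes>\<^sub>a counit_map C V W ev B) \<cdot> ((idt V \<otimes>\<^sub>a (idt W \<otimes>\<^sub>a a)) \<cdot> unit_map C V W coev (src C a))"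
    by (simp add: cmp_cmp)
  also have "\<dots> = ((idt V \<otimes>\<^sub>a counit_map C V W ev B) \<cdot> unit_map C V W coev (V \<otimes>\<^sub>o B)) \<cdot> a"
    by (subst unit_map_nat[OF assms(1), symmetric]) (simp_all add: cmp_cmp)
  also have "\<dots> = a" by (simp add: unit_counit[OF assms(1)])
  finally show ?thesis .
qed

text \<open>V \<otimes> _ is a right adjoint: \<open>f\<close> can be cancelled from the adjuncts
  \<open>?t a\<close> and \<open>?t b\<close>.\<close>

lemma dual_pair_tensor_mono:
  assumes "dual_pair V W ev coev" "is_mono C f"
  shows "is_mono C (idt V \<otimes>\<^sub>a f)"
proof (rule is_monoI)
  note [simp] = dual_pairD[OF assms(1)] is_mono_Ar[OF assms(2)] counit_map_simps[OF assms(1)]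
  show "idt V \<otimes>\<^sub>a f \<in> Ar C" by simp
  fix a b assume *: "a \<in> Ar C" "b \<in> Ar C" "tgt C a = src C (idt V \<otimes>\<^sub>a f)" "tgt C b = src C (idt V \<otimes>\<^sub>a f)"
    "src C a = src C b" "(idt V \<otimes>\<^sub>a f) \<cdot> a = (idt V \<otimes>\<^sub>a f) \<cdot> b"
  let ?t = "\<lambda>x. counit_map C V W ev (src C f) \<cdot> (idt W \<otimes>\<^sub>a x)"
  have "f \<cdot> ?t x = counit_map C V W ev (tgt C f) \<cdot> (idt W \<otimes>\<^sub>a ((idt V \<otimes>\<^sub>a f) \<cdot> x))"
    if "x \<in> Ar C" "tgt C x = V \<otimes>\<^sub>o src C f" for x
  proof -
    have "f \<cdot> ?t x = (f \<cdot> counit_map C V W ev (src C f)) \<cdot> (idt W \<otimes>\<^sub>a x)"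
      using that by (simp add: cmp_cmp)
    also have "\<dots> = counit_map C V W ev (tgt C f) \<cdot> ((idt W \<otimes>\<^sub>a (idt V \<otimes>\<^sub>a f)) \<cdot> (idt W \<otimes>\<^sub>a x))"
      using that by (subst counit_map_nat[OF assms(1), symmetric]) (simp_all add: cmp_cmp)
    also have "\<dots> = counit_map C V W ev (tgt C f) \<cdot> (idt W \<otimes>\<^sub>a ((idt V \<otimes>\<^sub>a f) \<cdot> x))"
      using that by (simp add: merge)
    finally show ?thesis .
  qed
  note step = this
  have "f \<cdot> ?t a = f \<cdot> ?t b"
    using step[of a] step[of b] *(1-4) unfolding *(6) by simp
  then have t: "?t a = ?t b" by (rule is_monoD[OF assms(2)]) (use *(1-5) in simp_all)
  have "a = (idt V \<otimes>\<^sub>a ?t a) \<cdot> unit_map C V W coev (src C a)"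
    by (rule transpose_right[OF assms(1), symmetric]) (use *(1-5) in simp_all)
  also have "\<dots> = (idt V \<otimes>\<^sub>a ?t b) \<cdot> unit_map C V W coev (src C b)"
    by (simp only: t *(5))
  also have "\<dots> = b"
    by (rule transpose_right[OF assms(1)]) (use *(1-5) in simp_all)
  finally show "a = b" .
qed

text \<open>Dually, W \<otimes> _ is a left adjoint and preserves epis.\<close>

lemma dual_pair_tensor_epi:
  assumes "dual_pair V W ev coev" "is_epi C q"
  shows "is_epi C (idt W \<otimes>\<^sub>a q)"
proof (rule is_epiI)
  note [simp] = dual_pairD[OF assms(1)] is_epi_Ar[OF assms(2)] unit_map_simps[OF assms(1)]
  show "idt W \<otimes>\<^sub>a q \<in> Ar C" by simp
  fix a b assume *: "a \<in> Ar C" "b \<in> Ar C" "src C a = tgt C (idt W \<otimes>\<^sub>a q)" "src C b = tgt C (idt W \<otimes>\<^sub>a q)"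
    "tgt C a = tgt C b" "a \<cdot> (idt W \<otimes>\<^sub>a q) = b \<cdot> (idt W \<otimes>\<^sub>a q)"
  let ?t = "\<lambda>x. (idt V \<otimes>\<^sub>a x) \<cdot> unit_map C V W coev (tgt C q)"
  have "?t x \<cdot> q = (idt V \<otimes>\<^sub>a (x \<cdot> (idt W \<otimes>\<^sub>a q))) \<cdot> unit_map C V W coev (src C q)"
    if "x \<in> Ar C" "src C x = W \<otimes>\<^sub>o tgt C q" for x
  proof -
    have "?t x \<cdot> q = (idt V \<otimes>\<^sub>a x) \<cdot> (unit_map C V W coev (tgt C q) \<cdot> q)"
      using that by (simp add: cmp_cmp)
    also have "\<dots> = (idt V \<otimes>\<^sub>a (x \<cdot> (idt W \<otimes>\<^sub>a q))) \<cdot> unit_map C V W coev (src C q)"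
      using that by (subst unit_map_nat[OF assms(1)]) (simp_all add: merge_cmp)
    finally show ?thesis .
  qed
  note step = this
  have "?t a \<cdot> q = ?t b \<cdot> q"
    using step[of a] step[of b] *(1-4) unfolding *(6) by simp
  then have t: "?t a = ?t b" by (rule is_epiD[OF assms(2)]) (use *(1-5) in simp_all)
  have "a = counit_map C V W ev (tgt C a) \<cdot> (idt W \<otimes>\<^sub>a ?t a)"
    by (rule transpose_left[OF assms(1), symmetric]) (use *(1-5) in simp_all)
  also have "\<dots> = counit_map C V W ev (tgt C b) \<cdot> (idt W \<otimes>\<^sub>a ?t b)"
    by (simp only: t *(5))
  also have "\<dots> = b"
    by (rule transpose_left[OF assms(1)]) (use *(1-5) in simp_all)
  finally show "a = b" .
qed


section \<open>Transposes of arrows between dualizable objects\<close>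

lemma transposed_counit:
  assumes V: "dual_pair V V' evV coevV" and W: "dual_pair W W' evW coevW"
    and f: "f \<in> Hom C W V" and g: "g \<in> Hom C V' W'"
    and fg: "evW \<cdot> (g \<otimes>\<^sub>a idt W) = evV \<cdot> (idt V' \<otimes>\<^sub>a f)" and B: "B \<in> Ob C"
  shows "counit_map C V V' evV B \<cdot> (idt V' \<otimes>\<^sub>a (f \<otimes>\<^sub>a idt B)) =
    counit_map C W W' evW B \<cdot> (g \<otimes>\<^sub>a idt (W \<otimes>\<^sub>o B))"
proof -
  note [simp] = dual_pairD[OF V] dual_pairD[OF W] HomD(1-3)[OF f] HomD(1-3)[OF g] B
  have "counit_map C V V' evV B \<cdot> (idt V' \<otimes>\<^sub>a (f \<otimes>\<^sub>a idt B)) =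
      \<l> B \<cdot> ((evV \<otimes>\<^sub>a idt B) \<cdot> (\<alpha>i V' V B \<cdot> (idt V' \<otimes>\<^sub>a (f \<otimes>\<^sub>a idt B))))"
    by (simp add: counit_map_def cmp_cmp)
  also have "\<alpha>i V' V B \<cdot> (idt V' \<otimes>\<^sub>a (f \<otimes>\<^sub>a idt B)) = ((idt V' \<otimes>\<^sub>a f) \<otimes>\<^sub>a idt B) \<cdot> \<alpha>i V' W B"
    using assoc_inv_nat[of "idt V'" f "idt B"] by simp
  \<comment> \<open>The hypothesis \<open>fg\<close>, which says that \<open>g\<close> is the
    transpose of \<open>f\<close>, enters here tensored with \<open>B\<close>.\<close>
  also have "\<l> B \<cdot> ((evV \<otimes>\<^sub>a idt B) \<cdot> (((idt V' \<otimes>\<^sub>a f) \<otimes>\<^sub>a idt B) \<cdot> \<alpha>i V' W B)) =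
      \<l> B \<cdot> (((evW \<cdot> (g \<otimes>\<^sub>a idt W)) \<otimes>\<^sub>a idt B) \<cdot> \<alpha>i V' W B)"
    by (simp add: merge_cmp fg)
  also have "\<dots> = \<l> B \<cdot> ((evW \<otimes>\<^sub>a idt B) \<cdot> (((g \<otimes>\<^sub>a idt W) \<otimes>\<^sub>a idt B) \<cdot> \<alpha>i V' W B))"
    by (simp add: merge_cmp)
  also have "((g \<otimes>\<^sub>a idt W) \<otimes>\<^sub>a idt B) \<cdot> \<alpha>i V' W B = \<alpha>i W' W B \<cdot> (g \<otimes>\<^sub>a idt (W \<otimes>\<^sub>o B))"
    using assoc_inv_nat[of g "idt W" "idt B"] by simp
  finally show ?thesis by (simp add: counit_map_def cmp_cmp)
qed

text \<open>Both sides have the adjunct \<open>g \<otimes>\<^sub>a idt B\<close>; for the right side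
  this follows from the counit version, so no second diagram chase is required.\<close>

lemma transposed_unit:
  assumes V: "dual_pair V V' evV coevV" and W: "dual_pair W W' evW coevW"
    and f: "f \<in> Hom C W V" and g: "g \<in> Hom C V' W'"
    and fg: "evW \<cdot> (g \<otimes>\<^sub>a idt W) = evV \<cdot> (idt V' \<otimes>\<^sub>a f)" and B: "B \<in> Ob C"
  shows "(idt V \<otimes>\<^sub>a (g \<otimes>\<^sub>a idt B)) \<cdot> unit_map C V V' coevV B =
    (f \<otimes>\<^sub>a idt (W' \<otimes>\<^sub>o B)) \<cdot> unit_map C W W' coevW B"
proof -
  note [simp] = dual_pairD[OF V] dual_pairD[OF W] HomD(1-3)[OF f] HomD(1-3)[OF g] B
    unit_map_simps[OF V] unit_map_simps[OF W] counit_map_simps[OF V] counit_map_simps[OF W]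
  let ?u = "unit_map C W W' coevW B"
  have "g \<otimes>\<^sub>a idt B = (counit_map C W W' evW (W' \<otimes>\<^sub>o B) \<cdot> (idt W' \<otimes>\<^sub>a ?u)) \<cdot> (g \<otimes>\<^sub>a idt B)"
    by (simp add: counit_unit[OF W])
  also have "\<dots> = (counit_map C W W' evW (W' \<otimes>\<^sub>o B) \<cdot> (g \<otimes>\<^sub>a idt (W \<otimes>\<^sub>o (W' \<otimes>\<^sub>o B)))) \<cdot> (idt V' \<otimes>\<^sub>a ?u)"
    by (simp add: cmp_simp)
  also have "\<dots> = counit_map C V V' evV (W' \<otimes>\<^sub>o B) \<cdot> (idt V' \<otimes>\<^sub>a ((f \<otimes>\<^sub>a idt (W' \<otimes>\<^sub>o B)) \<cdot> ?u))"
    by (subst transposed_counit[OF V W f g fg, symmetric]) (simp_all add: cmp_simp)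
  finally have "g \<otimes>\<^sub>a idt B = counit_map C V V' evV (W' \<otimes>\<^sub>o B) \<cdot>
      (idt V' \<otimes>\<^sub>a ((f \<otimes>\<^sub>a idt (W' \<otimes>\<^sub>o B)) \<cdot> ?u))" .
  then show ?thesis
    using transpose_right[OF V, of "W' \<otimes>\<^sub>o B" "(f \<otimes>\<^sub>a idt (W' \<otimes>\<^sub>o B)) \<cdot> ?u"] by simp
qed

text \<open>If \<open>a\<close> and \<open>b\<close> agree after
  \<open>g \<otimes>\<^sub>a idt B\<close>, then by \<open>transposed_unit\<close> their adjuncts
  agree when followed by f \<otimes> Z, where Z is the common target. That arrow is mono, and
  adjuncts determine arrows.\<close>

lemma transposed_epi:
  assumes V: "dual_pair V V' evV coevV" and W: "dual_pair W W' evW coevW"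
    and f: "f \<in> Hom C W V" and g: "g \<in> Hom C V' W'"
    and fg: "evW \<cdot> (g \<otimes>\<^sub>a idt W) = evV \<cdot> (idt V' \<otimes>\<^sub>a f)" and B: "B \<in> Ob C"
    and mono: "\<And>Z. Z \<in> Ob C \<Longrightarrow> is_mono C (f \<otimes>\<^sub>a idt Z)"
  shows "is_epi C (g \<otimes>\<^sub>a idt B)"
proof (rule is_epiI)
  note [simp] = dual_pairD[OF V] dual_pairD[OF W] HomD(1-3)[OF f] HomD(1-3)[OF g] B
    unit_map_simps[OF V] unit_map_simps[OF W] counit_map_simps[OF V] counit_map_simps[OF W]
  show "g \<otimes>\<^sub>a idt B \<in> Ar C" by simp
  fix a b assume *: "a \<in> Ar C" "b \<in> Ar C" "src C a = tgt C (g \<otimes>\<^sub>a idt B)" "src C b = tgt C (g \<otimes>\<^sub>a idt B)"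
    "tgt C a = tgt C b" "a \<cdot> (g \<otimes>\<^sub>a idt B) = b \<cdot> (g \<otimes>\<^sub>a idt B)"
  let ?t = "\<lambda>x. (idt W \<otimes>\<^sub>a x) \<cdot> unit_map C W W' coevW B"
  have "(f \<otimes>\<^sub>a idt (tgt C x)) \<cdot> ?t x = (idt V \<otimes>\<^sub>a (x \<cdot> (g \<otimes>\<^sub>a idt B))) \<cdot> unit_map C V V' coevV B"
    if "x \<in> Ar C" "src C x = W' \<otimes>\<^sub>o B" for x
  proof -
    have "(f \<otimes>\<^sub>a idt (tgt C x)) \<cdot> ?t x =
        (idt V \<otimes>\<^sub>a x) \<cdot> ((f \<otimes>\<^sub>a idt (W' \<otimes>\<^sub>o B)) \<cdot> unit_map C W W' coevW B)"
      using that by (simp add: merge_cmp)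
    also have "\<dots> = (idt V \<otimes>\<^sub>a (x \<cdot> (g \<otimes>\<^sub>a idt B))) \<cdot> unit_map C V V' coevV B"
      using that by (subst transposed_unit[OF V W f g fg B, symmetric]) (simp add: merge_cmp)
    finally show ?thesis .
  qed
  note step = this
  have sa: "src C a = W' \<otimes>\<^sub>o B" "src C b = W' \<otimes>\<^sub>o B" using *(3,4) by simp_all
  have "(f \<otimes>\<^sub>a idt (tgt C b)) \<cdot> ?t a = (f \<otimes>\<^sub>a idt (tgt C b)) \<cdot> ?t b"
    using step[OF *(1) sa(1)] step[OF *(2) sa(2)] unfolding *(5,6) by simp
  then have t: "?t a = ?t b" by (rule is_monoD[OF mono, rotated]) (use *(1,2,5) sa in simp_all)
  have "a = counit_map C W W' evW (tgt C a) \<cdot> (idt W' \<otimes>\<^sub>a ?t a)"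
    by (rule transpose_left[OF W, symmetric]) (use *(1,2) sa in simp_all)
  also have "\<dots> = counit_map C W W' evW (tgt C b) \<cdot> (idt W' \<otimes>\<^sub>a ?t b)"
    by (simp only: t *(5))
  also have "\<dots> = b"
    by (rule transpose_left[OF W]) (use *(1,2) sa in simp_all)
  finally show "a = b" .
qed

text \<open>The retraction \<open>t\<close> is the transpose of the section \<open>s\<close>:
  coevaluate W, apply \<open>s\<close> to the dual factor, evaluate on V. After \<open>f\<close>,
  the evaluation of V becomes that of W precomposed with \<open>g \<cdot> s\<close>, and a triangle
  identity remains.\<close>

lemma transposed_section_split:
  assumes V: "dual_pair V V' evV coevV" and W: "dual_pair W W' evW coevW"
    and f: "f \<in> Hom C W V" and g: "g \<in> Hom C V' W'"
    and fg: "evW \<cdot> (g \<otimes>\<^sub>a idt W) = evV \<cdot> (idt V' \<otimes>\<^sub>a f)" and B: "B \<in> Ob C"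
    and s: "s \<in> Hom C W' V'" "g \<cdot> s = idt W'"
  shows "split_mono C (f \<otimes>\<^sub>a idt B)"
proof -
  note [simp] = dual_pairD[OF V] dual_pairD[OF W] HomD(1-3)[OF f] HomD(1-3)[OF g] HomD(1-3)[OF s(1)] B
    unit_map_simps[OF V] unit_map_simps[OF W] counit_map_simps[OF V] counit_map_simps[OF W]
  let ?u = "\<lambda>X. unit_map C W W' coevW X"
  define t where "t = (idt W \<otimes>\<^sub>a (counit_map C V V' evV B \<cdot> (s \<otimes>\<^sub>a idt (V \<otimes>\<^sub>o B)))) \<cdot> ?u (V \<otimes>\<^sub>o B)"
  have "?u (V \<otimes>\<^sub>o B) \<cdot> (f \<otimes>\<^sub>a idt B) = (idt W \<otimes>\<^sub>a (idt W' \<otimes>\<^sub>a (f \<otimes>\<^sub>a idt B))) \<cdot> ?u (W \<otimes>\<^sub>o B)"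
    using unit_map_nat[OF W, of "f \<otimes>\<^sub>a idt B"] by simp
  then have "t \<cdot> (f \<otimes>\<^sub>a idt B) =
      (idt W \<otimes>\<^sub>a (counit_map C V V' evV B \<cdot> (s \<otimes>\<^sub>a (f \<otimes>\<^sub>a idt B)))) \<cdot> ?u (W \<otimes>\<^sub>o B)"
    by (simp add: t_def cmp_simp)
  also have "counit_map C V V' evV B \<cdot> (s \<otimes>\<^sub>a (f \<otimes>\<^sub>a idt B)) =
      (counit_map C V V' evV B \<cdot> (idt V' \<otimes>\<^sub>a (f \<otimes>\<^sub>a idt B))) \<cdot> (s \<otimes>\<^sub>a idt (W \<otimes>\<^sub>o B))"
    by (simp add: cmp_simp)
  also have "\<dots> = counit_map C W W' evW B"
    by (subst transposed_counit[OF V W f g fg B]) (simp add: cmp_simp s(2))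
  also have "(idt W \<otimes>\<^sub>a counit_map C W W' evW B) \<cdot> ?u (W \<otimes>\<^sub>o B) = idt (W \<otimes>\<^sub>o B)"
    by (rule unit_counit[OF W B])
  finally show ?thesis by (intro split_monoI[of t]) (simp_all add: t_def)
qed

end

section \<open>Commutative rigid categories\<close>

locale commutative_rigid_category = rigid_tensor_category K C
  for K :: "('k, 'r) ring_scheme" and C :: "('o, 'a, 'k, 'm) tensor_cat_scheme" (structure) +
  fixes c :: "'o \<Rightarrow> 'o \<Rightarrow> 'a"
  assumes swap_closed: "X \<in> Ob C \<Longrightarrow> Y \<in> Ob C \<Longrightarrow> c X Y \<in> Hom C (X \<otimes>\<^sub>o Y) (Y \<otimes>\<^sub>o X)"
    and swap_iso [simp]: "X \<in> Ob C \<Longrightarrow> Y \<in> Ob C \<Longrightarrow> is_iso C (c X Y)"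
    and swap_natural: "f \<in> Hom C X X' \<Longrightarrow> g \<in> Hom C Y Y'
      \<Longrightarrow> c X' Y' \<cdot> (f \<otimes>\<^sub>a g) = (g \<otimes>\<^sub>a f) \<cdot> c X Y"
begin

lemma swap_simps [simp]:
  assumes "X \<in> Ob C" "Y \<in> Ob C"
  shows "src C (c X Y) = X \<otimes>\<^sub>o Y" "tgt C (c X Y) = Y \<otimes>\<^sub>o X"
  using swap_closed[OF assms] by (simp_all add: Hom_iff)

lemma swap_nat: "f \<in> Ar C \<Longrightarrow> g \<in> Ar C
    \<Longrightarrow> c (tgt C f) (tgt C g) \<cdot> (f \<otimes>\<^sub>a g) = (g \<otimes>\<^sub>a f) \<cdot> c (src C f) (src C g)"
  by (rule swap_natural[OF Hom_self Hom_self])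

section \<open>Monos and epis under tensor products\<close>

lemma dual_pair_exists:
  assumes "V \<in> Ob C"
  obtains W ev coev where "dual_pair V W ev coev"
proof -
  obtain W where "is_left_dual C V W" using left_duals_exist[OF assms] by blast
  then obtain ev coev where "dual_pair V W ev coev" by (rule left_dual_dual_pair)
  then show ?thesis by (rule that)
qed

lemma tensor_left_mono:
  assumes "is_mono C f" "Z \<in> Ob C"
  shows "is_mono C (idt Z \<otimes>\<^sub>a f)"
  using dual_pair_exists[OF assms(2)] dual_pair_tensor_mono[OF _ assms(1)] by metis

text \<open>Preserving epis requires Z \<otimes> _ to be a left adjoint, so \<open>Z\<close> is
  written as the left dual of a right dual of itself.\<close>

lemma tensor_left_epi:
  assumes "is_epi C q" "Z \<in> Ob C"
  shows "is_epi C (idt Z \<otimes>\<^sub>a q)"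
  using right_duals_exist[OF assms(2)] left_dual_dual_pair dual_pair_tensor_epi[OF _ assms(1)] by metis

lemma tensor_right_mono:
  assumes "is_mono C f" "Z \<in> Ob C"
  shows "is_mono C (f \<otimes>\<^sub>a idt Z)"
proof (rule is_mono_right_factor)
  note [simp] = is_mono_Ar[OF assms(1)] assms(2)
  have "is_mono C ((idt Z \<otimes>\<^sub>a f) \<cdot> c (src C f) Z)"
    by (rule is_mono_cmp[OF is_iso_mono tensor_left_mono[OF assms]]) simp_all
  then show "is_mono C (c (tgt C f) Z \<cdot> (f \<otimes>\<^sub>a idt Z))"
    using swap_nat[of f "idt Z"] by simp
qed (use is_mono_Ar[OF assms(1)] assms(2) in simp_all)

section \<open>Subobjects and quotients of iterated tensor products\<close>

lemma embeds_tensor_left: "embeds C A B \<Longrightarrow> Z \<in> Ob C \<Longrightarrow> embeds C (Z \<otimes>\<^sub>o A) (Z \<otimes>\<^sub>o B)"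
  unfolding embeds_def using tensor_left_mono tensor_ar_closed[OF ident_closed] by blast

lemma embeds_tensor_right: "embeds C A B \<Longrightarrow> Z \<in> Ob C \<Longrightarrow> embeds C (A \<otimes>\<^sub>o Z) (B \<otimes>\<^sub>o Z)"
  unfolding embeds_def using tensor_right_mono tensor_ar_closed[OF _ ident_closed] by blast

lemma covers_tensor_left: "covers C A B \<Longrightarrow> Z \<in> Ob C \<Longrightarrow> covers C (Z \<otimes>\<^sub>o A) (Z \<otimes>\<^sub>o B)"
  unfolding covers_def using tensor_left_epi tensor_ar_closed[OF ident_closed] by blast

text \<open>Nested to the right, in contrast to \<open>tensor_power\<close>, so that the outermost
  factor is exposed and can be replaced or cancelled by induction.\<close>

abbreviation tensor_iter :: "'o \<Rightarrow> nat \<Rightarrow> 'o \<Rightarrow> 'o" where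
  "tensor_iter A n B \<equiv> (tensor_ob C A ^^ n) B"

lemma tensor_iter_Ob [simp]: "A \<in> Ob C \<Longrightarrow> B \<in> Ob C \<Longrightarrow> tensor_iter A n B \<in> Ob C"
  by (induction n) simp_all

lemma tensor_power_Ob [simp]: "A \<in> Ob C \<Longrightarrow> tensor_power C A n \<in> Ob C"
  by (induction n) simp_all

lemma embeds_tensor_iter:
  "embeds C A B \<Longrightarrow> Z \<in> Ob C \<Longrightarrow> embeds C (tensor_iter Z n A) (tensor_iter Z n B)"
  by (induction n) (simp_all add: embeds_tensor_left)

lemma covers_tensor_iter:
  "covers C A B \<Longrightarrow> Z \<in> Ob C \<Longrightarrow> covers C (tensor_iter Z n A) (tensor_iter Z n B)"
  by (induction n) (simp_all add: covers_tensor_left)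

lemma embeds_tensor_iter_base:
  assumes "embeds C W V" "W \<in> Ob C" "V \<in> Ob C" "B \<in> Ob C"
  shows "embeds C (tensor_iter W n B) (tensor_iter V n B)"
proof (induction n)
  case (Suc n)
  have "embeds C (W \<otimes>\<^sub>o tensor_iter W n B) (V \<otimes>\<^sub>o tensor_iter W n B)"
    using embeds_tensor_right assms by simp
  moreover have "embeds C (V \<otimes>\<^sub>o tensor_iter W n B) (V \<otimes>\<^sub>o tensor_iter V n B)"
    using embeds_tensor_left[OF Suc assms(3)] .
  ultimately show ?case using embeds_trans by simp
qed (simp add: embeds_refl assms)

text \<open>The hypothesis ranges over all \<open>B\<close> because the transposed epis arrive
  already tensored on the right, from \<open>transposed_epi\<close>.\<close>

lemma covers_tensor_iter_base:
  assumes "\<And>B. B \<in> Ob C \<Longrightarrow> covers C (V \<otimes>\<^sub>o B) (W \<otimes>\<^sub>o B)" "W \<in> Ob C" "V \<in> Ob C" "B \<in> Ob C"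
  shows "covers C (tensor_iter V n B) (tensor_iter W n B)"
proof (induction n)
  case (Suc n)
  have "covers C (V \<otimes>\<^sub>o tensor_iter V n B) (V \<otimes>\<^sub>o tensor_iter W n B)"
    using covers_tensor_left[OF Suc assms(3)] .
  moreover have "covers C (V \<otimes>\<^sub>o tensor_iter W n B) (W \<otimes>\<^sub>o tensor_iter W n B)"
    using assms by simp
  ultimately show ?case using covers_trans by simp
qed (simp add: covers_refl assms)

text \<open>Rebracketing moves one copy of \<open>V\<close> at a time from the power into
  \<open>B\<close>, hence the induction with arbitrary \<open>B\<close> and the unfolding of the
  iterate from inside.\<close>

lemma tensor_iter_embeds_tensor_power:
  assumes "V \<in> Ob C" "B \<in> Ob C"
  shows "embeds C (tensor_iter V n B) (tensor_power C V n \<otimes>\<^sub>o B)"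
  using assms(2)
proof (induction n arbitrary: B)
  case 0
  then show ?case by (auto intro!: embeds_iso'[of "\<l> B"])
next
  case (Suc n)
  have "embeds C (tensor_iter V n (V \<otimes>\<^sub>o B)) (tensor_power C V n \<otimes>\<^sub>o (V \<otimes>\<^sub>o B))"
    using Suc assms(1) by simp
  moreover have "embeds C (tensor_power C V n \<otimes>\<^sub>o (V \<otimes>\<^sub>o B)) ((tensor_power C V n \<otimes>\<^sub>o V) \<otimes>\<^sub>o B)"
    using Suc(2) assms(1) by (intro embeds_iso'[of "\<alpha> (tensor_power C V n) V B"]) simp_all
  ultimately show ?case
    using embeds_trans by (simp add: funpow_Suc_right del: funpow.simps)
qed

section \<open>Removing the factors behind f\<close>

lemma split_mono_cancel_factor:
  assumes W: "dual_pair W W' ev coev" and A: "A = W \<or> A = W'"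
    and f: "f \<in> Ar C" "src C f = W" and Z: "Z \<in> Ob C"
    and split: "split_mono C (f \<otimes>\<^sub>a idt (A \<otimes>\<^sub>o Z))"
  shows "split_mono C (f \<otimes>\<^sub>a idt Z)"
proof -
  note [simp] = dual_pairD[OF W] f Z
  have [simp]: "A \<in> Ob C" using A by auto
  let ?g = "f \<otimes>\<^sub>a idt Z"
  \<comment> \<open>One swap brings \<open>A\<close> to the front. A second one, inside
    \<open>A \<otimes>\<^sub>o _\<close>, restores the order
    \<open>f \<otimes>\<^sub>a idt Z\<close>, whose source W \<otimes> Z has the shape demanded by
    the cancellation lemmas.\<close>
  have "split_mono C (idt (A \<otimes>\<^sub>o Z) \<otimes>\<^sub>a f)"
    by (rule split_mono_conj[OF split, of "c (tgt C f) (A \<otimes>\<^sub>o Z)" _ "c W (A \<otimes>\<^sub>o Z)"])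
      (use swap_nat[of f "idt (A \<otimes>\<^sub>o Z)"] in simp_all)
  then have "split_mono C (idt A \<otimes>\<^sub>a (idt Z \<otimes>\<^sub>a f))"
    by (simp add: split_mono_tensor_tensor)
  then have "split_mono C (idt A \<otimes>\<^sub>a ?g)"
    by (rule split_mono_conj[of _ "idt A \<otimes>\<^sub>a c Z (tgt C f)" _ "idt A \<otimes>\<^sub>a c Z W"])
      (use swap_nat[of "idt Z" f] in \<open>simp_all add: merge is_iso_tensor\<close>)
  \<comment> \<open>A factor \<open>W'\<close> needs only tensoring with \<open>W\<close>; a factor
    \<open>W\<close> needs in addition the swap of \<open>W'\<close> and \<open>W\<close>.\<close>
  then show ?thesis
    using A split_mono_cancel_dual[OF W Z, of ?g]
      split_mono_cancel_self[OF W Z, of ?g "c W' W"] swap_closed[of W' W] by auto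
qed

lemma split_mono_cancel_iter:
  assumes W: "dual_pair W W' ev coev" and A: "A = W \<or> A = W'"
    and f: "f \<in> Ar C" "src C f = W" and Z: "Z \<in> Ob C"
    and split: "split_mono C (f \<otimes>\<^sub>a idt (tensor_iter A n Z))"
  shows "split_mono C (f \<otimes>\<^sub>a idt Z)"
  using split
proof (induction n)
  case (Suc n)
  have "tensor_iter A n Z \<in> Ob C" using A dual_pairD[OF W] Z by auto
  from split_mono_cancel_factor[OF W A f this] Suc show ?case by simp
qed simp

lemma split_mono_cancel_unit:
  assumes "split_mono C (f \<otimes>\<^sub>a idt I)" "f \<in> Ar C"
  shows "split_mono C f"
  by (rule split_mono_conj[OF assms(1), of "\<r> (tgt C f)" _ "\<r> (src C f)"])
    (use assms(2) runit_nat[of f] in simp_all)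

section \<open>From mixed tensor powers back to V\<close>

lemma mono_transposed:
  assumes V: "dual_pair V V' evV coevV" and W: "dual_pair W W' evW coevW"
    and f: "f \<in> Hom C W V" "is_mono C f"
  obtains g where "g \<in> Hom C V' W'" "evW \<cdot> (g \<otimes>\<^sub>a idt W) = evV \<cdot> (idt V' \<otimes>\<^sub>a f)"
    "\<And>B. B \<in> Ob C \<Longrightarrow> is_epi C (g \<otimes>\<^sub>a idt B)"
proof -
  note [simp] = dual_pairD[OF V] dual_pairD[OF W] HomD(1-3)[OF f(1)]
  have "evV \<cdot> (idt V' \<otimes>\<^sub>a f) \<in> Hom C (V' \<otimes>\<^sub>o W) I" by (simp add: Hom_iff)
  from evaluation_universal[OF W this] obtain g where
    g: "g \<in> Hom C V' W'" "evW \<cdot> (g \<otimes>\<^sub>a idt W) = evV \<cdot> (idt V' \<otimes>\<^sub>a f)" by auto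
  have "is_epi C (g \<otimes>\<^sub>a idt B)" if "B \<in> Ob C" for B
    by (rule transposed_epi[OF V W f(1) g that tensor_right_mono[OF f(2)]])
  then show ?thesis using that g by blast
qed

text \<open>Writing the exponent as \<open>Suc n\<close> reserves one factor \<open>V\<close> as the
  target of \<open>f\<close>; the other \<open>n\<close> factors and the \<open>m\<close> dual ones
  become cancellable after they are exchanged for \<open>W\<close> and \<open>W'\<close>.\<close>

lemma complemented_from_mixed_power:
  assumes V: "dual_pair V V' evV coevV"
    and ss: "complemented C (tensor_iter V (Suc n) (tensor_iter V' m I))"
  shows "complemented C V"
proof -
  note [simp] = dual_pairD[OF V]
  have "split_mono C f" if f: "is_mono C f" "tgt C f = V" for f
  proof -
    let ?W = "src C f"
    note [simp] = is_mono_Ar[OF f(1)] f(2)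
    obtain W' evW coevW where W: "dual_pair ?W W' evW coevW"
      by (rule dual_pair_exists[of ?W]) simp
    note [simp] = dual_pairD(2)[OF W]
    have fH: "f \<in> Hom C ?W V" by (simp add: Hom_iff)
    obtain g where g: "g \<in> Hom C V' W'" "\<And>B. B \<in> Ob C \<Longrightarrow> is_epi C (g \<otimes>\<^sub>a idt B)"
      using mono_transposed[OF V W fH f(1)] by metis
    have "covers C (V' \<otimes>\<^sub>o B) (W' \<otimes>\<^sub>o B)" if "B \<in> Ob C" for B
      unfolding covers_def using g(2)[OF that] tensor_ar_closed[OF g(1) ident_closed[OF that]] by blast
    then have "covers C (tensor_iter V' m I) (tensor_iter W' m I)"
      by (rule covers_tensor_iter_base) simp_all
    \<comment> \<open>The dual factors are replaced first, by a quotient underneath the unchanged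
      copies of \<open>V\<close>; the next steps take a subobject of the result.\<close>
    then have "complemented C (tensor_iter V (Suc n) (tensor_iter W' m I))"
      using complemented_covers[OF ss covers_tensor_iter] by simp
    moreover have "embeds C ?W V" using fH f(1) unfolding embeds_def by blast
    then have "embeds C (V \<otimes>\<^sub>o tensor_iter ?W n (tensor_iter W' m I))
        (V \<otimes>\<^sub>o tensor_iter V n (tensor_iter W' m I))"
      by (intro embeds_tensor_left embeds_tensor_iter_base) simp_all
    ultimately have "complemented C (V \<otimes>\<^sub>o tensor_iter ?W n (tensor_iter W' m I))"
      using complemented_embeds by simp
    moreover have "is_mono C (f \<otimes>\<^sub>a idt (tensor_iter ?W n (tensor_iter W' m I)))"
      by (rule tensor_right_mono[OF f(1)]) simp
    ultimately have "split_mono C (f \<otimes>\<^sub>a idt (tensor_iter ?W n (tensor_iter W' m I)))"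
      by (auto simp: complemented_def)
    \<comment> \<open>Cancels the \<open>n\<close> copies of \<open>W\<close>; the following step
      cancels the \<open>m\<close> copies of \<open>W'\<close>, leaving the unit.\<close>
    then have "split_mono C (f \<otimes>\<^sub>a idt (tensor_iter W' m I))"
      by (rule split_mono_cancel_iter[OF W, rotated -1]) simp_all
    then have "split_mono C (f \<otimes>\<^sub>a idt I)"
      by (rule split_mono_cancel_iter[OF W, rotated -1]) simp_all
    then show ?thesis by (rule split_mono_cancel_unit) simp
  qed
  then show ?thesis by (auto simp: complemented_def)
qed

lemma complemented_from_dual:
  assumes V: "dual_pair V V' evV coevV" and ss: "complemented C V'"
  shows "complemented C V"
proof -
  note [simp] = dual_pairD[OF V]
  have "split_mono C f" if f: "is_mono C f" "tgt C f = V" for f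
  proof -
    let ?W = "src C f"
    note [simp] = is_mono_Ar[OF f(1)] f(2)
    obtain W' evW coevW where W: "dual_pair ?W W' evW coevW"
      by (rule dual_pair_exists[of ?W]) simp
    have fH: "f \<in> Hom C ?W V" by (simp add: Hom_iff)
    obtain g where g: "g \<in> Hom C V' W'" "evW \<cdot> (g \<otimes>\<^sub>a idt ?W) = evV \<cdot> (idt V' \<otimes>\<^sub>a f)"
      "\<And>B. B \<in> Ob C \<Longrightarrow> is_epi C (g \<otimes>\<^sub>a idt B)"
      using mono_transposed[OF V W fH f(1)] by metis
    note [simp] = HomD(1-3)[OF g(1)] dual_pairD(2)[OF W]
    \<comment> \<open>Epis are available only in the form g \<otimes> B; the case of the unit
      recovers \<open>g\<close> itself, as tensoring with I is faithful.\<close>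
    have "is_epi C g"
    proof (rule is_epiI)
      fix a b assume *: "a \<in> Ar C" "b \<in> Ar C" "src C a = tgt C g" "src C b = tgt C g"
        "tgt C a = tgt C b" "a \<cdot> g = b \<cdot> g"
      have "(a \<otimes>\<^sub>a idt I) \<cdot> (g \<otimes>\<^sub>a idt I) = (b \<otimes>\<^sub>a idt I) \<cdot> (g \<otimes>\<^sub>a idt I)"
        using *(1-5) by (simp add: merge *(6))
      then have "a \<otimes>\<^sub>a idt I = b \<otimes>\<^sub>a idt I"
        by (rule is_epiD[OF g(3)[OF unit_Ob]]) (use *(1-5) in simp_all)
      then show "a = b" by (rule tensor_unit_faithful) (use *(1-5) in simp_all)
    qed simp
    then have "split_epi C g" using complemented_split_epi[OF ss] by simp
    then obtain s where "s \<in> Hom C W' V'" "g \<cdot> s = idt W'"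
      by (auto elim!: split_epiE simp: Hom_iff)
    from transposed_section_split[OF V W fH g(1,2) unit_Ob this]
    show ?thesis by (rule split_mono_cancel_unit) simp
  qed
  then show ?thesis by (auto simp: complemented_def)
qed

lemma complemented_tensor_power_imp:
  assumes V: "dual_pair V V' evV coevV" and mn: "\<not> (m = 0 \<and> n = 0)"
    and ss: "complemented C (tensor_power C V n \<otimes>\<^sub>o tensor_power C V' m)"
  shows "complemented C V"
proof -
  note [simp] = dual_pairD[OF V]
  \<comment> \<open>The iterate ends in I, so its comparison with the power leaves a unit factor to
    be absorbed.\<close>
  have "embeds C (tensor_power C V' m \<otimes>\<^sub>o I) (tensor_power C V' m)"
    by (rule embeds_iso[of "\<r> (tensor_power C V' m)"]) simp_all
  then have "embeds C (tensor_iter V' m I) (tensor_power C V' m)"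
    using embeds_trans tensor_iter_embeds_tensor_power[of V' I m] by simp
  then have "embeds C (tensor_iter V n (tensor_iter V' m I)) (tensor_iter V n (tensor_power C V' m))"
    by (rule embeds_tensor_iter) simp
  then have "embeds C (tensor_iter V n (tensor_iter V' m I)) (tensor_power C V n \<otimes>\<^sub>o tensor_power C V' m)"
    using embeds_trans tensor_iter_embeds_tensor_power[of V "tensor_power C V' m" n] by simp
  then have it: "complemented C (tensor_iter V n (tensor_iter V' m I))"
    using complemented_embeds ss by blast
  show ?thesis
  proof (cases n)
    case (Suc n')
    then show ?thesis using complemented_from_mixed_power[OF V] it by blast
  next
    case 0
    then obtain m' where m: "m = Suc m'" using mn by (cases m) auto
    obtain V'' ev' coev' where V': "dual_pair V' V'' ev' coev'"
      by (rule dual_pair_exists[of V']) simp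
    \<comment> \<open>The mixed power lemma is used with \<open>V'\<close> in the place of
      \<open>V\<close> and no dual factors: the inner iterate is then I by definition.\<close>
    have "complemented C (tensor_iter V' (Suc m') (tensor_iter V'' 0 I))" using it 0 m by simp
    then have "complemented C V'" by (rule complemented_from_mixed_power[OF V'])
    then show ?thesis by (rule complemented_from_dual[OF V])
  qed
qed

section \<open>Return to semisimple objects\<close>

lemma semisimple_iff_complemented: "X \<in> Ob C \<Longrightarrow> is_semisimple C X \<longleftrightarrow> complemented C X"
  using semisimple_imp_complemented complemented_imp_semisimple finite_length by blast

lemma semisimple_tensor_power_imp:
  assumes "is_left_dual C V V'" "\<not> (m = 0 \<and> n = 0)"
    and "is_semisimple C (tensor_power C V n \<otimes>\<^sub>o tensor_power C V' m)"
  shows "is_semisimple C V"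
proof -
  obtain ev coev where V: "dual_pair V V' ev coev" using left_dual_dual_pair[OF assms(1)] .
  show ?thesis
    using complemented_tensor_power_imp[OF V assms(2)] assms(3) semisimple_iff_complemented dual_pairD(1,2)[OF V]
    by simp
qed

end

theorem theorem3p1:
  fixes K :: "('k, 'r) ring_scheme" and C :: "('o, 'a, 'k, 'm) tensor_cat_scheme" and V :: 'o
  assumes "rigid_tensor_category K C"
    and "commutativity_condition C"
    and "V \<in> Ob C"
  shows "(\<forall>Vd m n. is_left_dual C V Vd \<longrightarrow> \<not> (m = 0 \<and> n = 0) \<longrightarrow>
            is_semisimple C (tensor_power C V n \<otimes>\<^sub>o\<^bsub>C\<^esub> tensor_power C Vd m) \<longrightarrow>
            is_semisimple C V) \<and>
         (\<forall>n \<ge> 1. is_semisimple C (tensor_power C V n) \<longrightarrow> is_semisimple C V)"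
proof -
  interpret rigid_tensor_category K C by (rule assms(1))
  obtain c where c: "\<forall>X \<in> Ob C. \<forall>Y \<in> Ob C.
      c X Y \<in> Hom C (X \<otimes>\<^sub>o\<^bsub>C\<^esub> Y) (Y \<otimes>\<^sub>o\<^bsub>C\<^esub> X) \<and> is_iso C (c X Y)"
    "\<forall>X \<in> Ob C. \<forall>X' \<in> Ob C. \<forall>Y \<in> Ob C. \<forall>Y' \<in> Ob C. \<forall>f \<in> Hom C X X'. \<forall>g \<in> Hom C Y Y'.
      c X' Y' \<cdot>\<^bsub>C\<^esub> (f \<otimes>\<^sub>a\<^bsub>C\<^esub> g) = (g \<otimes>\<^sub>a\<^bsub>C\<^esub> f) \<cdot>\<^bsub>C\<^esub> c X Y"
    using assms(2) unfolding commutativity_condition_def by blast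
  interpret commutative_rigid_category K C c
  proof
    fix X Y X' Y' f g
    show "c X' Y' \<cdot>\<^bsub>C\<^esub> (f \<otimes>\<^sub>a\<^bsub>C\<^esub> g) = (g \<otimes>\<^sub>a\<^bsub>C\<^esub> f) \<cdot>\<^bsub>C\<^esub> c X Y"
      if fg: "f \<in> Hom C X X'" "g \<in> Hom C Y Y'"
      using c(2) fg HomD(4,5)[OF fg(1)] HomD(4,5)[OF fg(2)] by blast
  qed (use c(1) in auto)
  have mixed: "is_semisimple C V"
    if "is_left_dual C V Vd" "\<not> (m = 0 \<and> n = 0)"
      "is_semisimple C (tensor_power C V n \<otimes>\<^sub>o\<^bsub>C\<^esub> tensor_power C Vd m)" for Vd m n
    using semisimple_tensor_power_imp that by blast
  have "is_semisimple C V" if n: "n \<ge> 1" and ss: "is_semisimple C (tensor_power C V n)" for n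
  proof -
    obtain Vd where Vd: "is_left_dual C V Vd" using left_duals_exist assms(3) by blast
    \<comment> \<open>The pure power is the case m = 0 up to the right unitor; semisimplicity
      crosses that isomorphism in its complemented form.\<close>
    have "embeds C (tensor_power C V n \<otimes>\<^sub>o\<^bsub>C\<^esub> I) (tensor_power C V n)"
      by (rule embeds_iso[of "\<r> (tensor_power C V n)"]) (simp_all add: assms(3))
    then have "is_semisimple C (tensor_power C V n \<otimes>\<^sub>o\<^bsub>C\<^esub> tensor_power C Vd 0)"
      using ss complemented_embeds by (simp add: semisimple_iff_complemented assms(3))
    from mixed[OF Vd _ this] n show ?thesis by simp
  qed
  with mixed show ?thesis by (intro conjI allI impI)
qed

end
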